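(* Let $G$ be a countably infinite discrete group and $H\leq G$ a subgroup such that $H\subseteq Z(G)$ (the center of $G$) and $[G:H]<+\infty$. If $(X,H,\alpha)$ is a topological dynamical system and $(X_H^G,G,\alpha^{H\backslash G})$ is its co-induced system, then $$h_{top}^*(X_H^G,G)=[G:H]\,h_{top}^*(X,H).$$
   Context: A topological dynamical system (t.d.s.) $(X,G,\alpha)$ consists of a compact metric space $X$, a group $G$, and an action $(g,x)\mapsto\alpha_g(x)$ of $G$ on $X$ by homeomorphisms. Co-induced system: let $H\leq G$, let $H\backslash G$ be the set of right cosets $Hg$, and fix a section $s:H\backslash G\to G$ (so $s(\theta)\in\theta$) with $s(H)=e$. Given a t.d.s. $(X,H,\alpha)$, put $X_H^G=\prod_{\theta\in H\backslash G}X$ (functions $f:H\backslash G\to X$, product topology), with $G$-action $$\alpha^{H\backslash G}_{g_0}(f)(Hg)=\alpha_{s(Hg)g_0s(Hgg_0)^{-1}}\big(f(Hgg_0)\big).$$ Up to conjugacy of $G$-systems this does not depend on the section $s$. Maximal pattern entropy: for an open cover $\mathcal{U}$ of $X$, let $N(\mathcal{U})$ be the minimal cardinality of a subcover, and $$p^*_{X,G,\mathcal{U}}(n)=\max_{(g_1,\dots,g_n)\in G^n}N\Big(\bigvee_{i=1}^n\alpha_{g_i^{-1}}(\mathcal{U})\Big),\quad h_{top}^*(\mathcal{U},G)=\lim_{n\to\infty}\frac1n\log p^*_{X,G,\mathcal{U}}(n),$$ $$h_{top}^*(X,G)=\sup_{\mathcal{U}}h_{top}^*(\mathcal{U},G)\in[0,+\infty],$$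 the supremum being over all open covers of $X$ (the limit exists by subadditivity). *)

theory Defs
  imports "HOL-Analysis.Analysis" "HOL-Algebra.Group_Action"
begin

text \<open>
  A compact metric space enters only through its topology, so it is represented by a compact
  metrizable topology.  The group is discrete, so no continuity in the group variable is required.
  The library's \<^locale>\<open>group_action\<close> takes each group element to an extensional bijection of
  the space, that is, to a map whose values off the space carry no information.
\<close>

definition tds :: "('g, 'm) monoid_scheme \<Rightarrow> 'x topology \<Rightarrow> ('g \<Rightarrow> 'x \<Rightarrow> 'x) \<Rightarrow> bool" where
  "tds G X \<alpha> \<longleftrightarrow>
     compact_space X \<and> metrizable_space X \<and>
     group_action G (topspace X) \<alpha> \<and>
     (\<forall>g \<in> carrier G. homeomorphic_map X X (\<alpha> g))"

definition group_center :: "('g, 'm) monoid_scheme \<Rightarrow> 'g set" where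
  "group_center G = {z \<in> carrier G. \<forall>g \<in> carrier G. z \<otimes>\<^bsub>G\<^esub> g = g \<otimes>\<^bsub>G\<^esub> z}"

definition coset_section ::
  "('g, 'm) monoid_scheme \<Rightarrow> 'g set \<Rightarrow> ('g set \<Rightarrow> 'g) \<Rightarrow> bool" where
  "coset_section G H s \<longleftrightarrow> (\<forall>\<theta> \<in> rcosets\<^bsub>G\<^esub> H. s \<theta> \<in> \<theta>) \<and> s H = \<one>\<^bsub>G\<^esub>"

definition coind_space ::
  "('g, 'm) monoid_scheme \<Rightarrow> 'g set \<Rightarrow> 'x topology \<Rightarrow> ('g set \<Rightarrow> 'x) topology" where
  "coind_space G H X = product_topology (\<lambda>\<theta>. X) (rcosets\<^bsub>G\<^esub> H)"

text \<open>For a coset \<open>\<theta> = Hg\<close>, the coset \<open>Hgg\<^sub>0\<close> is \<open>\<theta> #> g\<^sub>0\<close>.\<close>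

definition coind_action ::
  "('g, 'm) monoid_scheme \<Rightarrow> 'g set \<Rightarrow> ('g set \<Rightarrow> 'g) \<Rightarrow> 'x topology \<Rightarrow> ('g \<Rightarrow> 'x \<Rightarrow> 'x) \<Rightarrow>
   'g \<Rightarrow> ('g set \<Rightarrow> 'x) \<Rightarrow> ('g set \<Rightarrow> 'x)" where
  "coind_action G H s X \<alpha> g\<^sub>0 =
     (\<lambda>f \<in> topspace (coind_space G H X). \<lambda>\<theta> \<in> rcosets\<^bsub>G\<^esub> H.
        \<alpha> (s \<theta> \<otimes>\<^bsub>G\<^esub> g\<^sub>0 \<otimes>\<^bsub>G\<^esub> inv\<^bsub>G\<^esub> (s (\<theta> #>\<^bsub>G\<^esub> g\<^sub>0))) (f (\<theta> #>\<^bsub>G\<^esub> g\<^sub>0)))"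

definition open_cover :: "'x topology \<Rightarrow> 'x set set \<Rightarrow> bool" where
  "open_cover X \<U> \<longleftrightarrow> (\<forall>U \<in> \<U>. openin X U) \<and> \<Union>\<U> = topspace X"

definition cover_number :: "'x topology \<Rightarrow> 'x set set \<Rightarrow> nat" where
  "cover_number X \<U> =
     (LEAST n. \<exists>\<V> \<subseteq> \<U>. finite \<V> \<and> card \<V> = n \<and> \<Union>\<V> = topspace X)"

text \<open>The factor \<open>topspace X\<close> matters only for the empty join, which it makes the trivial cover.\<close>

definition cover_join :: "'x topology \<Rightarrow> 'i set \<Rightarrow> ('i \<Rightarrow> 'x set set) \<Rightarrow> 'x set set" where
  "cover_join X I \<U> = {topspace X \<inter> (\<Inter>i\<in>I. U i) | U. \<forall>i\<in>I. U i \<in> \<U> i}"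

definition max_pattern_number ::
  "('g, 'm) monoid_scheme \<Rightarrow> 'x topology \<Rightarrow> ('g \<Rightarrow> 'x \<Rightarrow> 'x) \<Rightarrow> 'x set set \<Rightarrow> nat \<Rightarrow> nat" where
  "max_pattern_number G X \<alpha> \<U> n =
     Max {cover_number X (cover_join X {1..n} (\<lambda>i. (\<lambda>U. \<alpha> (inv\<^bsub>G\<^esub> (g i)) ` U) ` \<U>)) | g.
          g \<in> {1..n} \<rightarrow>\<^sub>E carrier G}"

definition pattern_entropy_cover ::
  "('g, 'm) monoid_scheme \<Rightarrow> 'x topology \<Rightarrow> ('g \<Rightarrow> 'x \<Rightarrow> 'x) \<Rightarrow> 'x set set \<Rightarrow> real" where
  "pattern_entropy_cover G X \<alpha> \<U> =
     lim (\<lambda>n. 1 / real n * ln (real (max_pattern_number G X \<alpha> \<U> n)))"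

definition pattern_entropy ::
  "('g, 'm) monoid_scheme \<Rightarrow> 'x topology \<Rightarrow> ('g \<Rightarrow> 'x \<Rightarrow> 'x) \<Rightarrow> ereal" where
  "pattern_entropy G X \<alpha> = (SUP \<U> \<in> Collect (open_cover X). ereal (pattern_entropy_cover G X \<alpha> \<U>))"

lemma coset_section_cocycle:
  assumes "group G" "subgroup H G" "coset_section G H s"
    and "\<theta> \<in> rcosets\<^bsub>G\<^esub> H" "g \<in> carrier G"
  shows "\<theta> #>\<^bsub>G\<^esub> g \<in> rcosets\<^bsub>G\<^esub> H" "s \<theta> \<in> carrier G" "s (\<theta> #>\<^bsub>G\<^esub> g) \<in> carrier G"
    "s \<theta> \<otimes>\<^bsub>G\<^esub> g \<otimes>\<^bsub>G\<^esub> inv\<^bsub>G\<^esub> (s (\<theta> #>\<^bsub>G\<^esub> g)) \<in> H"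
proof -
  interpret group G by fact
  interpret subgroup H G by fact
  obtain a where a: "a \<in> carrier G" "\<theta> = H #>\<^bsub>G\<^esub> a"
    using assms(4) by (auto simp: RCOSETS_def)
  have eq: "\<theta> #>\<^bsub>G\<^esub> g = H #>\<^bsub>G\<^esub> (a \<otimes>\<^bsub>G\<^esub> g)"
    using a assms(5) by (simp add: coset_mult_assoc subset)
  show R: "\<theta> #>\<^bsub>G\<^esub> g \<in> rcosets\<^bsub>G\<^esub> H"
    unfolding eq using a assms(5) by (simp add: rcosetsI subset)
  have "s \<theta> \<in> H #>\<^bsub>G\<^esub> a" "s (\<theta> #>\<^bsub>G\<^esub> g) \<in> H #>\<^bsub>G\<^esub> (a \<otimes>\<^bsub>G\<^esub> g)"
    using assms(3,4) R a eq by (auto simp: coset_section_def)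
  then obtain h k where h: "h \<in> H" "s \<theta> = h \<otimes>\<^bsub>G\<^esub> a"
    and k: "k \<in> H" "s (\<theta> #>\<^bsub>G\<^esub> g) = k \<otimes>\<^bsub>G\<^esub> (a \<otimes>\<^bsub>G\<^esub> g)"
    by (auto simp: r_coset_def)
  show "s \<theta> \<in> carrier G" "s (\<theta> #>\<^bsub>G\<^esub> g) \<in> carrier G"
    using h k a assms(5) by auto
  have "s \<theta> \<otimes>\<^bsub>G\<^esub> g \<otimes>\<^bsub>G\<^esub> inv\<^bsub>G\<^esub> (s (\<theta> #>\<^bsub>G\<^esub> g)) =
        h \<otimes>\<^bsub>G\<^esub> (a \<otimes>\<^bsub>G\<^esub> g) \<otimes>\<^bsub>G\<^esub> (inv\<^bsub>G\<^esub> (a \<otimes>\<^bsub>G\<^esub> g) \<otimes>\<^bsub>G\<^esub> inv\<^bsub>G\<^esub> k)"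
    using h k a assms(5) by (simp add: m_assoc inv_mult_group)
  also have "\<dots> = h \<otimes>\<^bsub>G\<^esub> inv\<^bsub>G\<^esub> k"
  proof -
    have "x \<otimes>\<^bsub>G\<^esub> (inv\<^bsub>G\<^esub> x \<otimes>\<^bsub>G\<^esub> y) = y" if "x \<in> carrier G" "y \<in> carrier G" for x y
      using that by (simp add: m_assoc[symmetric])
    then have "h \<otimes>\<^bsub>G\<^esub> x \<otimes>\<^bsub>G\<^esub> (inv\<^bsub>G\<^esub> x \<otimes>\<^bsub>G\<^esub> inv\<^bsub>G\<^esub> k) = h \<otimes>\<^bsub>G\<^esub> inv\<^bsub>G\<^esub> k"
      if "x \<in> carrier G" for x
      using h k that by (simp add: m_assoc)
    then show ?thesis using a assms(5) by simp
  qed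
  finally show "s \<theta> \<otimes>\<^bsub>G\<^esub> g \<otimes>\<^bsub>G\<^esub> inv\<^bsub>G\<^esub> (s (\<theta> #>\<^bsub>G\<^esub> g)) \<in> H"
    using h k by simp
qed

lemma tds_coind:
  assumes G: "group G" and cnt: "countable (carrier G)" and H: "subgroup H G"
    and s: "coset_section G H s" and X: "tds (G\<lparr>carrier := H\<rparr>) X \<alpha>"
  shows "tds G (coind_space G H X) (coind_action G H s X \<alpha>)"
proof -
  interpret group G by fact
  interpret sH: subgroup H G by fact
  interpret A: group_action "G\<lparr>carrier := H\<rparr>" "topspace X" \<alpha>
    using X by (simp add: tds_def)
  define R where "R = rcosets\<^bsub>G\<^esub> H"
  define P where "P = coind_space G H X"
  define \<beta> where "\<beta> = coind_action G H s X \<alpha>"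
  define c where "c \<theta> g = s \<theta> \<otimes>\<^bsub>G\<^esub> g \<otimes>\<^bsub>G\<^esub> inv\<^bsub>G\<^esub> (s (\<theta> #>\<^bsub>G\<^esub> g))" for \<theta> g
  note coc = coset_section_cocycle[OF G H s, folded R_def]
  have tP: "topspace P = R \<rightarrow>\<^sub>E topspace X"
    by (simp add: P_def coind_space_def R_def)
  have hm: "homeomorphic_map X X (\<alpha> h)" if "h \<in> H" for h
    using X that by (simp add: tds_def)
  have hE: "\<alpha> h x \<in> topspace X" if "h \<in> H" "x \<in> topspace X" for h x
    using A.element_image[of h x] that by auto
  have cR: "countable R"
  proof -
    have "R = (\<lambda>a. H #>\<^bsub>G\<^esub> a) ` carrier G" by (auto simp: R_def RCOSETS_def)
    then show ?thesis using cnt by simp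
  qed
  have \<beta>: "\<beta> g f = (\<lambda>\<theta>\<in>R. \<alpha> (c \<theta> g) (f (\<theta> #>\<^bsub>G\<^esub> g)))" if "f \<in> topspace P" for g f
    using that by (simp add: \<beta>_def coind_action_def R_def c_def P_def)
  have cH: "c \<theta> g \<in> H" if "\<theta> \<in> R" "g \<in> carrier G" for \<theta> g
    using coc that by (simp add: c_def)
  have cont: "continuous_map P P (\<beta> g)" if g: "g \<in> carrier G" for g
  proof -
    have "continuous_map P X (\<lambda>f. \<alpha> (c \<theta> g) (f (\<theta> #>\<^bsub>G\<^esub> g)))" if "\<theta> \<in> R" for \<theta>
    proof -
      have "continuous_map P X (\<lambda>f. f (\<theta> #>\<^bsub>G\<^esub> g))"
        unfolding P_def coind_space_def R_def[symmetric]
        by (rule continuous_map_product_projection) (use coc that g in auto)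
      then have "continuous_map P X (\<alpha> (c \<theta> g) \<circ> (\<lambda>f. f (\<theta> #>\<^bsub>G\<^esub> g)))"
        by (rule continuous_map_compose)
          (use hm cH that g homeomorphic_imp_continuous_map in blast)
      then show ?thesis by (simp add: o_def)
    qed
    then have "continuous_map P P (\<lambda>f. \<lambda>\<theta>\<in>R. \<alpha> (c \<theta> g) (f (\<theta> #>\<^bsub>G\<^esub> g)))"
      by (subst (2) P_def)
        (auto simp: coind_space_def R_def[symmetric] continuous_map_componentwise)
    then show ?thesis
      by (rule continuous_map_eq) (simp add: \<beta>)
  qed
  have in\<beta>: "\<beta> g f \<in> topspace P" if "g \<in> carrier G" "f \<in> topspace P" for g f
    using cont[OF that(1)] that(2) by (auto simp: continuous_map_def)
  have comp: "\<beta> (g \<otimes>\<^bsub>G\<^esub> k) f = \<beta> g (\<beta> k f)"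
    if g: "g \<in> carrier G" and k: "k \<in> carrier G" and f: "f \<in> topspace P" for g k f
  proof (rule ext)
    fix \<theta>
    show "\<beta> (g \<otimes>\<^bsub>G\<^esub> k) f \<theta> = \<beta> g (\<beta> k f) \<theta>"
    proof (cases "\<theta> \<in> R")
      case True
      note t1 = coc[OF True g]
      note t2 = coc[OF t1(1) k]
      have sub: "\<theta> \<subseteq> carrier G"
        using True rcosets_subset_PowG[OF H] by (auto simp: R_def)
      have assoc: "\<theta> #>\<^bsub>G\<^esub> (g \<otimes>\<^bsub>G\<^esub> k) = \<theta> #>\<^bsub>G\<^esub> g #>\<^bsub>G\<^esub> k"
        using coset_mult_assoc[OF sub g k] by simp
      have cc: "c \<theta> (g \<otimes>\<^bsub>G\<^esub> k) = c \<theta> g \<otimes>\<^bsub>G\<^esub> c (\<theta> #>\<^bsub>G\<^esub> g) k"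
      proof -
        let ?b = "s (\<theta> #>\<^bsub>G\<^esub> g)"
        have "inv\<^bsub>G\<^esub> ?b \<otimes>\<^bsub>G\<^esub> (?b \<otimes>\<^bsub>G\<^esub> y) = y" if "y \<in> carrier G" for y
          using t1 that by (simp add: m_assoc[symmetric])
        then show ?thesis
          using t1 t2 g k by (simp add: c_def assoc m_assoc)
      qed
      have fx: "f (\<theta> #>\<^bsub>G\<^esub> g #>\<^bsub>G\<^esub> k) \<in> topspace X"
        using f t2(1) by (auto simp: tP)
      have "\<alpha> (c \<theta> g \<otimes>\<^bsub>G\<^esub> c (\<theta> #>\<^bsub>G\<^esub> g) k) (f (\<theta> #>\<^bsub>G\<^esub> g #>\<^bsub>G\<^esub> k)) =
            \<alpha> (c \<theta> g) (\<alpha> (c (\<theta> #>\<^bsub>G\<^esub> g) k) (f (\<theta> #>\<^bsub>G\<^esub> g #>\<^bsub>G\<^esub> k)))"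
        using A.composition_rule[OF fx, of "c \<theta> g" "c (\<theta> #>\<^bsub>G\<^esub> g) k"] cH t1 True g k by simp
      then show ?thesis
        unfolding \<beta>[OF in\<beta>[OF k f]] using True t1 by (simp add: \<beta>[OF f] assoc cc)
    next
      case False
      then show ?thesis unfolding \<beta>[OF in\<beta>[OF k f]] by (simp add: \<beta>[OF f])
    qed
  qed
  have one: "\<beta> \<one>\<^bsub>G\<^esub> f = f" if f: "f \<in> topspace P" for f
  proof (rule ext)
    fix \<theta>
    show "\<beta> \<one>\<^bsub>G\<^esub> f \<theta> = f \<theta>"
    proof (cases "\<theta> \<in> R")
      case True
      have sub: "\<theta> \<subseteq> carrier G"
        using True rcosets_subset_PowG[OF H] by (auto simp: R_def)
      have e: "\<theta> #>\<^bsub>G\<^esub> \<one>\<^bsub>G\<^esub> = \<theta>" using sub by (rule coset_mult_one)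
      have "c \<theta> \<one>\<^bsub>G\<^esub> = \<one>\<^bsub>G\<^esub>"
        using coc[OF True one_closed] by (simp add: c_def e)
      moreover have "\<alpha> \<one>\<^bsub>G\<^esub> (f \<theta>) = f \<theta>"
        using fun_cong[OF A.id_eq_one, of "f \<theta>"] f True by (auto simp: tP PiE_iff)
      ultimately show ?thesis using True f by (simp add: \<beta> e)
    next
      case False
      then show ?thesis using f by (auto simp: \<beta> tP PiE_iff extensional_def)
    qed
  qed
  have homeo: "homeomorphic_maps P P (\<beta> g) (\<beta> (inv\<^bsub>G\<^esub> g))" if g: "g \<in> carrier G" for g
    unfolding homeomorphic_maps_def
    using cont[OF g] cont[OF inv_closed[OF g]] comp[OF g inv_closed[OF g]]
      comp[OF inv_closed[OF g] g] one g by (metis l_inv r_inv)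
  have Bij: "\<beta> g \<in> Bij (topspace P)" if g: "g \<in> carrier G" for g
  proof -
    have "bij_betw (\<beta> g) (topspace P) (topspace P)"
      using homeo[OF g] by (metis bij_betw_def homeomorphic_imp_injective_map
          homeomorphic_imp_surjective_map homeomorphic_maps_map)
    moreover have "\<beta> g \<in> extensional (topspace P)"
      by (simp add: \<beta>_def coind_action_def P_def)
    ultimately show ?thesis by (simp add: Bij_def)
  qed
  have "group_action G (topspace P) \<beta>"
  proof (intro group_action.intro group_hom.intro group_hom_axioms.intro G group_BijGroup)
    have "\<beta> (g \<otimes>\<^bsub>G\<^esub> k) = compose (topspace P) (\<beta> g) (\<beta> k)"
      if "g \<in> carrier G" "k \<in> carrier G" for g k
    proof (rule extensionalityI)
      show "\<beta> (g \<otimes>\<^bsub>G\<^esub> k) \<in> extensional (topspace P)"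
        by (simp add: \<beta>_def coind_action_def P_def)
    qed (use comp that in \<open>auto simp: compose_def\<close>)
    then show "\<beta> \<in> hom G (BijGroup (topspace P))"
      using Bij by (auto simp: hom_def BijGroup_def)
  qed
  moreover have "compact_space P"
    using X by (simp add: P_def coind_space_def compact_space_product_topology tds_def)
  moreover have "metrizable_space P"
    using X cR by (auto simp: P_def coind_space_def metrizable_space_product_topology tds_def
        R_def[symmetric] intro: countable_subset[of _ R])
  moreover have "\<forall>g\<in>carrier G. homeomorphic_map P P (\<beta> g)"
    using homeo homeomorphic_maps_map by blast
  ultimately show ?thesis
    by (simp add: tds_def P_def[symmetric] \<beta>_def[symmetric])
qed

end

theory Submission
  imports Defs
begin

text \<open>
  Let \<open>k\<close> be the index of \<open>H\<close>.  As \<open>k\<close> is finite, every open cover of \<open>X\<^sup>k\<close> is refined by a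
  power of an open cover of \<open>X\<close>, and \<open>G\<close> maps product sets to product sets, moving each
  coordinate by an element of \<open>H\<close>.  Hence \<open>n\<close> elements of \<open>G\<close> turn such a power into a product
  of \<open>k\<close> patterns of length \<open>n\<close> for \<open>H\<close>, which gives one inequality.  Conversely, centrality
  makes \<open>H\<close> act diagonally on \<open>X\<^sup>k\<close>.  Subcover numbers are not multiplicative on products, but
  cardinalities of separated sets are, and the two are interlaced once a cover is replaced by
  a star refinement.
\<close>

text \<open>The star refinement \<V> is chosen from \<U> alone, and star refinement survives
  translation by homeomorphisms as well as joins. Hence one \<V> serves every length n and every
  tuple, and the change of cover disappears in the supremum over covers. Diagonality matters because
  the lower bound needs one tuple that is optimal in all coordinates at once; for a general subgroup
  the cocycle could turn it into different tuples in different coordinates, with no reason for all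
  of them to be optimal. Both comparisons of pattern numbers hold for each n with the same exponent
  k, so k survives as a factor when the logarithm is divided by n.\<close>

section \<open>Averages of subadditive sequences\<close>

text \<open>Fekete's argument: with n = q * m + r and r < m, subadditivity gives a n \<le> q * a m +
  a r, so division by n leaves a m / m up to a bounded remainder over n. Nonnegativity keeps the
  infimum \<open>L\<close> finite and permits rounding q up to n / m.\<close>

lemma subadditive_convergent:
  fixes a :: "nat \<Rightarrow> real"
  assumes sub: "\<And>m n. a (m + n) \<le> a m + a n" and nonneg: "\<And>n. 0 \<le> a n"
  shows "convergent (\<lambda>n. 1 / real n * a n)"
proof -
  define L where "L = (INF n\<in>{1..}. a n / real n)"
  have bdd: "bdd_below ((\<lambda>n. a n / real n) ` {1..})"
    by (rule bdd_belowI[of _ 0]) (auto simp: nonneg)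
  have "(\<lambda>n. a n / real n) \<longlonglongrightarrow> L"
  proof (rule LIMSEQ_I)
    fix e :: real
    assume "0 < e"
    have "L < L + e / 2" using \<open>0 < e\<close> by simp
    then obtain m where m: "m \<ge> 1" "a m / real m < L + e / 2"
      using cInf_lessD[of "(\<lambda>n. a n / real n) ` {1..}" "L + e / 2"] unfolding L_def by auto
    \<comment> \<open>A common bound for all remainder terms \<open>a r\<close>; the sum dominates
      its summands because they are nonnegative.\<close>
    define M where "M = (\<Sum>r<m. a r)"
    have M: "a r \<le> M" if "r < m" for r
      unfolding M_def by (rule member_le_sum) (use that nonneg in auto)
    have mult: "a (q * m + r) \<le> real q * a m + a r" for q r
    proof (induction q)
      case (Suc q)
      have "a (Suc q * m + r) \<le> a m + a (q * m + r)"
        using sub[of m "q * m + r"] by (simp add: add.assoc)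
      with Suc show ?case by (simp add: algebra_simps)
    qed simp
    have bound: "a n / real n \<le> a m / real m + M / real n" if "n \<ge> 1" for n
    proof -
      have "a n \<le> real (n div m) * a m + a (n mod m)"
        using mult[of "n div m" "n mod m"] by simp
      also have "\<dots> \<le> real n / real m * a m + M"
      proof (rule add_mono)
        show "real (n div m) * a m \<le> real n / real m * a m"
          by (intro mult_right_mono nonneg of_nat_div_le_of_nat)
        show "a (n mod m) \<le> M" using m by (intro M) simp
      qed
      finally have "a n / real n \<le> (real n / real m * a m + M) / real n"
        by (intro divide_right_mono) auto
      then show ?thesis using that by (simp add: add_divide_distrib)
    qed
    obtain N :: nat where N: "real N > 2 * M / e" using reals_Archimedean2 by blast
    show "\<exists>no. \<forall>n\<ge>no. norm (a n / real n - L) < e"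
    proof (intro exI allI impI)
      fix n
      assume n: "n \<ge> max 1 N"
      have "L \<le> a n / real n"
        unfolding L_def using n by (intro cINF_lower bdd) auto
      moreover have "M / real n < e / 2"
      proof -
        have "real n > 2 * M / e" using N n by linarith
        then show ?thesis using n \<open>0 < e\<close> by (simp add: field_simps)
      qed
      moreover have "a n / real n \<le> a m / real m + M / real n" using n by (intro bound) simp
      ultimately have "L \<le> a n / real n" "a n / real n < L + e" using m(2) by linarith+
      then show "norm (a n / real n - L) < e" by simp
    qed
  qed
  then show ?thesis by (auto simp: convergent_def)
qed

subsection \<open>Covers, joins and cover numbers\<close>

lemma open_cover_translate:
  assumes "homeomorphic_map X X \<phi>" and "open_cover X \<U>"
  shows "open_cover X ((\<lambda>U. \<phi> ` U) ` \<U>)"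
proof -
  have "\<phi> ` topspace X = topspace X"
    using assms(1) by (rule homeomorphic_imp_surjective_map)
  moreover have "openin X (\<phi> ` U)" if "U \<in> \<U>" for U
    using assms that homeomorphic_map_openness[OF assms(1), of U]
    by (auto simp: open_cover_def dest: openin_subset)
  ultimately show ?thesis
    using assms(2) unfolding open_cover_def by (auto simp flip: image_Union)
qed

lemma open_cover_join:
  assumes "finite I" and "\<And>i. i \<in> I \<Longrightarrow> open_cover X (\<U> i)"
  shows "open_cover X (cover_join X I \<U>)"
  unfolding open_cover_def
proof (intro conjI ballI)
  fix W
  assume "W \<in> cover_join X I \<U>"
  then obtain U where U: "\<forall>i\<in>I. U i \<in> \<U> i" and W: "W = topspace X \<inter> (\<Inter>i\<in>I. U i)"
    by (auto simp: cover_join_def)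
  show "openin X W"
  proof (cases "I = {}")
    case False
    then have "openin X (\<Inter>i\<in>I. U i)"
      using assms U by (intro openin_Inter) (auto simp: open_cover_def)
    then show ?thesis unfolding W by blast
  qed (simp add: W)
next
  show "\<Union> (cover_join X I \<U>) = topspace X"
  proof (intro equalityI subsetI)
    fix x
    assume x: "x \<in> topspace X"
    then have "\<forall>i\<in>I. \<exists>U. U \<in> \<U> i \<and> x \<in> U"
      using assms(2) by (fastforce simp: open_cover_def)
    then obtain U where "\<forall>i\<in>I. U i \<in> \<U> i \<and> x \<in> U i" by metis
    then show "x \<in> \<Union> (cover_join X I \<U>)"
      using x by (auto simp: cover_join_def intro!: exI[of _ "topspace X \<inter> (\<Inter>i\<in>I. U i)"])
  qed (auto simp: cover_join_def)
qed

text \<open>Compactness provides the witness without which the \<open>LEAST\<close> in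
  \<open>cover_number\<close> would be unspecified.\<close>

lemma cover_number_attained:
  assumes "compact_space X" and "open_cover X \<U>"
  obtains \<V> where "\<V> \<subseteq> \<U>" "finite \<V>" "card \<V> = cover_number X \<U>" "\<Union>\<V> = topspace X"
proof -
  obtain \<F> where "finite \<F>" "\<F> \<subseteq> \<U>" "topspace X \<subseteq> \<Union>\<F>"
    using assms compactinD[of X "topspace X" \<U>] unfolding compact_space_def open_cover_def by auto
  moreover from this have "\<Union>\<F> = topspace X" using assms(2) unfolding open_cover_def by blast
  ultimately have "\<exists>n. \<exists>\<V> \<subseteq> \<U>. finite \<V> \<and> card \<V> = n \<and> \<Union>\<V> = topspace X" by blast
  from LeastI_ex[OF this] show ?thesis
    unfolding cover_number_def[symmetric] using that by blast
qed

text \<open>Enlarging each set of \<W> to a member of \<U> cannot increase their number. This form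
  admits stars, which are unions of members of another cover, as \<W>.\<close>

lemma cover_number_le_card:
  assumes "open_cover X \<U>" and "finite \<W>" and "topspace X \<subseteq> \<Union>\<W>"
    and "\<And>W. W \<in> \<W> \<Longrightarrow> \<exists>U\<in>\<U>. W \<subseteq> U"
  shows "cover_number X \<U> \<le> card \<W>"
proof -
  obtain \<phi> where \<phi>: "\<And>W. W \<in> \<W> \<Longrightarrow> \<phi> W \<in> \<U> \<and> W \<subseteq> \<phi> W" using assms(4) by metis
  have "\<Union>(\<phi> ` \<W>) = topspace X"
    using \<phi> assms(1,3) by (fastforce simp: open_cover_def)
  then have "\<exists>\<V> \<subseteq> \<U>. finite \<V> \<and> card \<V> = card (\<phi> ` \<W>) \<and> \<Union>\<V> = topspace X"
    using \<phi> assms(2) by (intro exI[of _ "\<phi> ` \<W>"]) auto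
  then have "cover_number X \<U> \<le> card (\<phi> ` \<W>)"
    unfolding cover_number_def by (rule Least_le)
  also have "\<dots> \<le> card \<W>" using assms(2) by (rule card_image_le)
  finally show ?thesis .
qed

lemma cover_number_refine:
  assumes "compact_space X" and "open_cover X \<U>" and "open_cover X \<V>"
    and "\<And>V. V \<in> \<V> \<Longrightarrow> \<exists>U\<in>\<U>. V \<subseteq> U"
  shows "cover_number X \<U> \<le> cover_number X \<V>"
proof -
  obtain \<W> where \<W>: "\<W> \<subseteq> \<V>" "finite \<W>" "card \<W> = cover_number X \<V>" "\<Union>\<W> = topspace X"
    using cover_number_attained[OF assms(1,3)] .
  have "cover_number X \<U> \<le> card \<W>"
    using \<W> assms(4) by (intro cover_number_le_card[OF assms(2)]) auto
  then show ?thesis using \<W>(3) by simp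
qed

lemma cover_number_translate_le:
  assumes "compact_space X" and "homeomorphic_map X X \<phi>" and "open_cover X \<U>"
  shows "cover_number X ((\<lambda>U. \<phi> ` U) ` \<U>) \<le> cover_number X \<U>"
proof -
  obtain \<W> where \<W>: "\<W> \<subseteq> \<U>" "finite \<W>" "card \<W> = cover_number X \<U>" "\<Union>\<W> = topspace X"
    using cover_number_attained[OF assms(1,3)] .
  have "\<phi> ` topspace X = topspace X"
    using assms(2) by (rule homeomorphic_imp_surjective_map)
  then have "topspace X \<subseteq> \<Union>((\<lambda>U. \<phi> ` U) ` \<W>)" using \<W>(4) by (metis image_Union order_refl)
  then have "cover_number X ((\<lambda>U. \<phi> ` U) ` \<U>) \<le> card ((\<lambda>U. \<phi> ` U) ` \<W>)"
    using \<W> by (intro cover_number_le_card open_cover_translate assms) auto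
  also have "\<dots> \<le> cover_number X \<U>" using \<W> card_image_le by metis
  finally show ?thesis .
qed

lemma cover_number_join_le:
  assumes "compact_space X" and "finite I" and U: "\<And>i. i \<in> I \<Longrightarrow> open_cover X (\<U> i)"
  shows "cover_number X (cover_join X I \<U>) \<le> (\<Prod>i\<in>I. cover_number X (\<U> i))"
proof -
  have "\<forall>i\<in>I. \<exists>\<W>. \<W> \<subseteq> \<U> i \<and> finite \<W> \<and> card \<W> = cover_number X (\<U> i) \<and> \<Union>\<W> = topspace X"
    using cover_number_attained[OF assms(1) U] by metis
  then obtain \<W> where \<W>: "\<And>i. i \<in> I \<Longrightarrow> \<W> i \<subseteq> \<U> i" "\<And>i. i \<in> I \<Longrightarrow> finite (\<W> i)"
    "\<And>i. i \<in> I \<Longrightarrow> card (\<W> i) = cover_number X (\<U> i)" "\<And>i. i \<in> I \<Longrightarrow> \<Union>(\<W> i) = topspace X"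
    by metis
  let ?J = "\<lambda>V. topspace X \<inter> (\<Inter>i\<in>I. V i)"
  have fin: "finite (Pi\<^sub>E I \<W>)" using assms(2) \<W>(2) by (intro finite_PiE)
  have "topspace X \<subseteq> \<Union>(?J ` Pi\<^sub>E I \<W>)"
  proof
    fix x
    assume x: "x \<in> topspace X"
    then have "\<forall>i\<in>I. \<exists>V. V \<in> \<W> i \<and> x \<in> V" using \<W>(4) by blast
    then obtain V where V: "\<forall>i\<in>I. V i \<in> \<W> i \<and> x \<in> V i" by metis
    then have "restrict V I \<in> Pi\<^sub>E I \<W>" "x \<in> ?J (restrict V I)" using x by auto
    then show "x \<in> \<Union>(?J ` Pi\<^sub>E I \<W>)" by blast
  qed
  moreover have "\<exists>U\<in>cover_join X I \<U>. W \<subseteq> U" if W: "W \<in> ?J ` Pi\<^sub>E I \<W>" for W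
  proof -
    obtain V where "V \<in> Pi\<^sub>E I \<W>" "W = ?J V" using W by blast
    then have "W \<in> cover_join X I \<U>" using \<W>(1) unfolding cover_join_def by blast
    then show ?thesis by blast
  qed
  ultimately have "cover_number X (cover_join X I \<U>) \<le> card (?J ` Pi\<^sub>E I \<W>)"
    using fin by (intro cover_number_le_card open_cover_join assms) auto
  also have "\<dots> \<le> card (Pi\<^sub>E I \<W>)" using fin by (rule card_image_le)
  also have "\<dots> = (\<Prod>i\<in>I. cover_number X (\<U> i))"
    using assms(2) \<W>(3) by (simp add: card_PiE)
  finally show ?thesis .
qed

text \<open>Indexing by \<open>bool\<close> makes the product of two cover numbers an instance of
  the bound for families; the join of the two partial joins refines the join over I \<union>
  J.\<close>

lemma cover_number_join_Un_le:
  assumes "compact_space X" and "finite I" "finite J"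
    and "\<And>i. i \<in> I \<union> J \<Longrightarrow> open_cover X (\<U> i)"
  shows "cover_number X (cover_join X (I \<union> J) \<U>) \<le>
         cover_number X (cover_join X I \<U>) * cover_number X (cover_join X J \<U>)"
proof -
  let ?\<W> = "\<lambda>b. if b then cover_join X I \<U> else cover_join X J \<U>"
  have oc: "open_cover X (cover_join X K \<U>)" if "K \<subseteq> I \<union> J" for K
    using that assms by (intro open_cover_join) (auto intro: finite_subset)
  have "cover_number X (cover_join X (I \<union> J) \<U>) \<le> cover_number X (cover_join X UNIV ?\<W>)"
  proof (rule cover_number_refine)
    show "open_cover X (cover_join X UNIV ?\<W>)"
      by (rule open_cover_join) (auto intro: oc)
    fix W
    assume "W \<in> cover_join X UNIV ?\<W>"
    then obtain A where A: "\<forall>b. A b \<in> ?\<W> b" and W: "W = topspace X \<inter> (\<Inter>b. A b)"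
      by (auto simp: cover_join_def)
    have "A True \<in> cover_join X I \<U>" "A False \<in> cover_join X J \<U>"
      using spec[OF A, of True] spec[OF A, of False] by auto
    then obtain B C where B: "\<forall>i\<in>I. B i \<in> \<U> i" "A True = topspace X \<inter> (\<Inter>i\<in>I. B i)"
      and C: "\<forall>i\<in>J. C i \<in> \<U> i" "A False = topspace X \<inter> (\<Inter>i\<in>J. C i)"
      by (auto simp: cover_join_def)
    \<comment> \<open>On the overlap of I and J the choice made for I wins; this only drops
      constraints, so \<open>W\<close> stays inside.\<close>
    let ?D = "\<lambda>i. if i \<in> I then B i else C i"
    have "topspace X \<inter> (\<Inter>i\<in>I \<union> J. ?D i) \<in> cover_join X (I \<union> J) \<U>"
      using B(1) C(1) unfolding cover_join_def by (intro CollectI exI[of _ ?D]) auto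
    moreover have "W \<subseteq> topspace X \<inter> (\<Inter>i\<in>I \<union> J. ?D i)"
      unfolding W using B(2) C(2) by (auto simp: UNIV_bool)
    ultimately show "\<exists>U\<in>cover_join X (I \<union> J) \<U>. W \<subseteq> U" by blast
  qed (use assms oc in auto)
  also have "\<dots> \<le> (\<Prod>b\<in>UNIV. cover_number X (?\<W> b))"
    by (rule cover_number_join_le) (auto simp: assms oc)
  also have "\<dots> = cover_number X (cover_join X I \<U>) * cover_number X (cover_join X J \<U>)"
    by (simp add: UNIV_bool mult.commute)
  finally show ?thesis .
qed

text \<open>A block of consecutive indices has to be renumbered from 1 before it is a pattern
  again.\<close>

lemma cover_join_reindex:
  assumes "bij_betw \<pi> I J"
  shows "cover_join X J \<U> = cover_join X I (\<lambda>i. \<U> (\<pi> i))"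
proof -
  have J: "J = \<pi> ` I" and inj: "inj_on \<pi> I" using assms by (auto simp: bij_betw_def)
  show ?thesis
  proof (intro equalityI subsetI)
    fix W
    assume "W \<in> cover_join X J \<U>"
    then obtain U where "\<forall>j\<in>J. U j \<in> \<U> j" "W = topspace X \<inter> (\<Inter>j\<in>J. U j)"
      by (auto simp: cover_join_def)
    then show "W \<in> cover_join X I (\<lambda>i. \<U> (\<pi> i))"
      unfolding cover_join_def J by (auto intro!: exI[of _ "\<lambda>i. U (\<pi> i)"])
  next
    fix W
    assume "W \<in> cover_join X I (\<lambda>i. \<U> (\<pi> i))"
    then obtain U where U: "\<forall>i\<in>I. U i \<in> \<U> (\<pi> i)" "W = topspace X \<inter> (\<Inter>i\<in>I. U i)"
      by (auto simp: cover_join_def)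
    let ?V = "\<lambda>j. U (inv_into I \<pi> j)"
    have "\<forall>j\<in>J. ?V j \<in> \<U> j" "W = topspace X \<inter> (\<Inter>j\<in>J. ?V j)"
      using U inj by (auto simp: J)
    then show "W \<in> cover_join X J \<U>" unfolding cover_join_def by blast
  qed
qed

lemma cover_join_cong:
  assumes "\<And>i. i \<in> I \<Longrightarrow> \<U> i = \<V> i"
  shows "cover_join X I \<U> = cover_join X I \<V>"
proof -
  have "(\<forall>i\<in>I. U i \<in> \<U> i) \<longleftrightarrow> (\<forall>i\<in>I. U i \<in> \<V> i)" for U using assms by simp
  then show ?thesis unfolding cover_join_def by presburger
qed

subsection \<open>Star refinements and separated sets\<close>

text \<open>Point stars of \<open>\<V>\<close> lie in members of \<open>\<U>\<close>; this plays the role of \<open>\<V>\<close> being finer than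
  half a Lebesgue number of \<open>\<U>\<close>.\<close>

definition star_refines :: "'x topology \<Rightarrow> 'x set set \<Rightarrow> 'x set set \<Rightarrow> bool" where
  "star_refines X \<V> \<U> \<longleftrightarrow> (\<forall>x\<in>topspace X. \<exists>U\<in>\<U>. \<forall>V\<in>\<V>. x \<in> V \<longrightarrow> V \<subseteq> U)"

text \<open>The counterpart for covers of an \<epsilon>-separated set in a metric space.\<close>

definition separated_by :: "'x set set \<Rightarrow> 'x set \<Rightarrow> bool" where
  "separated_by \<V> E \<longleftrightarrow> (\<forall>V\<in>\<V>. \<forall>x\<in>E \<inter> V. \<forall>y\<in>E \<inter> V. x = y)"

text \<open>Pigeonhole: sending each point of \<open>E\<close> to a member of a minimal subcover
  that contains it is injective.\<close>

lemma card_separated_le_cover_number: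
  assumes "compact_space X" and "open_cover X \<V>" and "E \<subseteq> topspace X" and "separated_by \<V> E"
  shows "finite E" and "card E \<le> cover_number X \<V>"
proof -
  obtain \<W> where \<W>: "\<W> \<subseteq> \<V>" "finite \<W>" "card \<W> = cover_number X \<V>" "\<Union>\<W> = topspace X"
    using cover_number_attained[OF assms(1,2)] .
  have "\<forall>x\<in>E. \<exists>V. V \<in> \<W> \<and> x \<in> V" using \<W>(4) assms(3) by blast
  then obtain \<phi> where \<phi>: "\<And>x. x \<in> E \<Longrightarrow> \<phi> x \<in> \<W> \<and> x \<in> \<phi> x" by metis
  have inj: "inj_on \<phi> E"
  proof (rule inj_onI)
    fix x y
    assume "x \<in> E" "y \<in> E" "\<phi> x = \<phi> y"
    then have "\<phi> x \<in> \<V>" "x \<in> E \<inter> \<phi> x" "y \<in> E \<inter> \<phi> x"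
      using \<phi>[of x] \<phi>[of y] \<W>(1) by auto
    then show "x = y" using assms(4) unfolding separated_by_def by blast
  qed
  have sub: "\<phi> ` E \<subseteq> \<W>" using \<phi> by auto
  show "finite E" using inj_on_finite[OF inj sub \<W>(2)] .
  show "card E \<le> cover_number X \<V>" using card_inj_on_le[OF inj sub \<W>(2)] \<W>(3) by simp
qed

text \<open>A separated set of greatest cardinality is maximal, so every point shares a member of
  \<V> with it. The stars of its points therefore cover the space, and each star fits into one
  member of \<U>.\<close>

lemma ex_separated_ge_cover_number:
  assumes "compact_space X" and "open_cover X \<V>" and "open_cover X \<U>" and "star_refines X \<V> \<U>"
  obtains E where "E \<subseteq> topspace X" "separated_by \<V> E" "cover_number X \<U> \<le> card E"
proof -
  define P where "P k \<longleftrightarrow> (\<exists>E \<subseteq> topspace X. separated_by \<V> E \<and> card E = k)" for k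
  have bound: "k \<le> cover_number X \<V>" if "P k" for k
    using that card_separated_le_cover_number(2)[OF assms(1,2)] by (auto simp: P_def)
  have "P 0" unfolding P_def by (intro exI[of _ "{}"]) (auto simp: separated_by_def)
  then have "P (GREATEST k. P k)" by (rule GreatestI_nat) (rule bound)
  then obtain E where E: "E \<subseteq> topspace X" "separated_by \<V> E" "card E = (GREATEST k. P k)"
    unfolding P_def by blast
  have fin: "finite E" using card_separated_le_cover_number(1)[OF assms(1,2) E(1,2)] .
  define st where "st x = \<Union>{V \<in> \<V>. x \<in> V}" for x
  have "x \<in> \<Union>(st ` E)" if x: "x \<in> topspace X" for x
  proof (rule ccontr)
    assume not: "x \<notin> \<Union>(st ` E)"
    have V: "\<exists>V\<in>\<V>. x \<in> V" using x assms(2) by (auto simp: open_cover_def)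
    have notE: "x \<notin> E" using not V by (auto simp: st_def)
    \<comment> \<open>A common member of \<V> for \<open>x\<close> and a point of \<open>E\<close>
      would put \<open>x\<close> into the star of that point.\<close>
    have "separated_by \<V> (insert x E)"
      using E(2) not unfolding separated_by_def st_def by blast
    then have "P (card (insert x E))" unfolding P_def using E(1) x by blast
    then have "card (insert x E) \<le> card E"
      unfolding E(3) by (rule Greatest_le_nat) (rule bound)
    then show False using notE fin by simp
  qed
  then have "cover_number X \<U> \<le> card (st ` E)"
  proof (intro cover_number_le_card[OF assms(3)])
    fix W
    assume "W \<in> st ` E"
    then obtain x where "x \<in> E" "W = st x" by auto
    then show "\<exists>U\<in>\<U>. W \<subseteq> U"
      using assms(4) E(1) unfolding star_refines_def st_def
      by (metis (mono_tags, lifting) Sup_least mem_Collect_eq subsetD)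
  qed (use fin in auto)
  also have "\<dots> \<le> card E" using fin by (rule card_image_le)
  finally show ?thesis using that E by blast
qed

text \<open>Injectivity of \<phi> on the space shows that a translated member passes through \<phi>
  x only if the original member passes through x; \<open>open_cover\<close> ensures that the members
  of \<V> lie in the space.\<close>

lemma star_refines_translate:
  assumes "homeomorphic_map X X \<phi>" and "open_cover X \<V>" and "star_refines X \<V> \<U>"
  shows "star_refines X ((\<lambda>V. \<phi> ` V) ` \<V>) ((\<lambda>U. \<phi> ` U) ` \<U>)"
  unfolding star_refines_def
proof
  fix y
  assume "y \<in> topspace X"
  then obtain x where x: "x \<in> topspace X" "y = \<phi> x"
    using homeomorphic_imp_surjective_map[OF assms(1)] by blast
  then obtain U where U: "U \<in> \<U>" "\<And>V. V \<in> \<V> \<Longrightarrow> x \<in> V \<Longrightarrow> V \<subseteq> U"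
    using assms(3) unfolding star_refines_def by metis
  have inj: "inj_on \<phi> (topspace X)" using assms(1) by (rule homeomorphic_imp_injective_map)
  have "x \<in> V" if "V \<in> \<V>" "y \<in> \<phi> ` V" for V
    using that x inj assms(2) unfolding open_cover_def by (auto dest: inj_onD)
  then show "\<exists>W\<in>(\<lambda>U. \<phi> ` U) ` \<U>. \<forall>V\<in>(\<lambda>V. \<phi> ` V) ` \<V>. y \<in> V \<longrightarrow> V \<subseteq> W"
    using U by (intro bexI[of _ "\<phi> ` U"]) (auto simp del: image_subset_iff intro!: image_mono)
qed

text \<open>At a point x, members chosen index by index to contain the star of x intersect to a
  member of the join that contains its star there.\<close>

lemma star_refines_join:
  assumes "\<And>i. i \<in> I \<Longrightarrow> star_refines X (\<V> i) (\<U> i)"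
  shows "star_refines X (cover_join X I \<V>) (cover_join X I \<U>)"
  unfolding star_refines_def
proof
  fix x
  assume x: "x \<in> topspace X"
  then have "\<forall>i\<in>I. \<exists>U. U \<in> \<U> i \<and> (\<forall>V\<in>\<V> i. x \<in> V \<longrightarrow> V \<subseteq> U)"
    using assms unfolding star_refines_def by blast
  then obtain U where U: "\<And>i. i \<in> I \<Longrightarrow> U i \<in> \<U> i"
    "\<And>i V. i \<in> I \<Longrightarrow> V \<in> \<V> i \<Longrightarrow> x \<in> V \<Longrightarrow> V \<subseteq> U i"
    by metis
  show "\<exists>W\<in>cover_join X I \<U>. \<forall>V\<in>cover_join X I \<V>. x \<in> V \<longrightarrow> V \<subseteq> W"
  proof (intro bexI[of _ "topspace X \<inter> (\<Inter>i\<in>I. U i)"] ballI impI)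
    fix V
    assume "V \<in> cover_join X I \<V>" "x \<in> V"
    then obtain A where A: "\<forall>i\<in>I. A i \<in> \<V> i" "V = topspace X \<inter> (\<Inter>i\<in>I. A i)" "\<forall>i\<in>I. x \<in> A i"
      by (auto simp: cover_join_def)
    then show "V \<subseteq> topspace X \<inter> (\<Inter>i\<in>I. U i)" using U(2) by blast
  next
    show "topspace X \<inter> (\<Inter>i\<in>I. U i) \<in> cover_join X I \<U>"
      using U(1) unfolding cover_join_def by blast
  qed
qed

text \<open>A Lebesgue number argument: finitely many balls of radius \<open>r x\<close> cover the
  space while the doubled balls lie in members of \<U>; the doubling leaves room for the star of a
  point in the smaller ball.\<close>

lemma ex_star_refinement:
  assumes "compact_space X" and "metrizable_space X" and "open_cover X \<U>"
  obtains \<V> where "open_cover X \<V>" "star_refines X \<V> \<U>"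
proof -
  obtain M d where md: "Metric_space M d" and X: "X = Metric_space.mtopology M d"
    using assms(2) unfolding metrizable_space_def by blast
  interpret Metric_space M d by (rule md)
  have top: "topspace X = M" by (simp add: X)
  have "\<exists>U r. U \<in> \<U> \<and> 0 < r \<and> mball x (2 * r) \<subseteq> U" if x: "x \<in> M" for x
  proof -
    obtain U where U: "U \<in> \<U>" "x \<in> U" using x assms(3) by (auto simp: open_cover_def top)
    then have "openin mtopology U" using assms(3) by (simp add: open_cover_def X)
    then obtain r where "r > 0" "mball x r \<subseteq> U" using U(2) by (auto simp: openin_mtopology)
    then show ?thesis using U(1) by (intro exI[of _ U] exI[of _ "r / 2"]) auto
  qed
  then obtain U r where U: "\<And>x. x \<in> M \<Longrightarrow> U x \<in> \<U>" and r: "\<And>x. x \<in> M \<Longrightarrow> 0 < r x"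
    and sub: "\<And>x. x \<in> M \<Longrightarrow> mball x (2 * r x) \<subseteq> U x"
    by metis
  let ?B = "(\<lambda>x. mball x (r x)) ` M"
  have "compactin X M" using assms(1) by (simp add: compact_space_def top)
  moreover have "openin X V" if "V \<in> ?B" for V using that by (auto simp: X)
  moreover have "M \<subseteq> \<Union>?B" using r by auto
  ultimately obtain \<F> where \<F>: "finite \<F>" "\<F> \<subseteq> ?B" "M \<subseteq> \<Union>\<F>"
    using compactinD[of X M ?B] by blast
  obtain F where F: "F \<subseteq> M" "finite F" "\<F> = (\<lambda>x. mball x (r x)) ` F"
    using finite_subset_image[OF \<F>(1,2)] by blast
  \<comment> \<open>The \<open>1\<close> keeps \<open>Min\<close> defined when \<open>F\<close> is
    empty, which happens only for the empty space.\<close>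
  define \<delta> where "\<delta> = Min (insert 1 (r ` F))"
  have \<delta>: "0 < \<delta>" "\<And>x. x \<in> F \<Longrightarrow> \<delta> \<le> r x"
    using F(1,2) r by (auto simp: \<delta>_def)
  let ?\<V> = "(\<lambda>x. mball x (\<delta> / 2)) ` M"
  have "open_cover X ?\<V>"
    unfolding open_cover_def using \<delta>(1) by (auto simp: top X)
  moreover have "star_refines X ?\<V> \<U>"
    unfolding star_refines_def top
  proof
    fix y
    assume y: "y \<in> M"
    then obtain x where x: "x \<in> F" "y \<in> mball x (r x)" using \<F>(3) F(3) by blast
    have "mball z (\<delta> / 2) \<subseteq> U x" if "z \<in> M" "y \<in> mball z (\<delta> / 2)" for z
    proof
      fix w
      assume w: "w \<in> mball z (\<delta> / 2)"
      \<comment> \<open>A common ball of radius \<open>\<delta> / 2\<close> places \<open>w\<close>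
        at distance less than \<delta> from \<open>y\<close>, hence less than
        \<open>r x + \<delta>\<close>, which is at most \<open>2 * r x\<close>, from
        \<open>x\<close>.\<close>
      have "d y w \<le> d z y + d z w" using w that(1) y triangle[of y z w] commute[of y z] by auto
      moreover have "d x w \<le> d x y + d y w" using w x y F(1) by (intro triangle) auto
      ultimately have "d x w < r x + \<delta>" using w that(2) x(2) by auto
      then have "w \<in> mball x (2 * r x)" using \<delta>(2)[OF x(1)] w x F(1) by auto
      then show "w \<in> U x" using sub x(1) F(1) by blast
    qed
    then show "\<exists>U\<in>\<U>. \<forall>V\<in>?\<V>. y \<in> V \<longrightarrow> V \<subseteq> U" using U x(1) F(1) by blast
  qed
  ultimately show ?thesis by (rule that)
qed

subsection \<open>Product covers\<close>

definition cover_prod :: "'i set \<Rightarrow> ('i \<Rightarrow> 'x set set) \<Rightarrow> ('i \<Rightarrow> 'x) set set" where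
  "cover_prod I \<U> = {Pi\<^sub>E I U | U. \<forall>i\<in>I. U i \<in> \<U> i}"

lemma open_cover_prod:
  assumes "finite I" and "\<And>i. i \<in> I \<Longrightarrow> open_cover (X i) (\<U> i)"
  shows "open_cover (product_topology X I) (cover_prod I \<U>)"
  unfolding open_cover_def
proof (intro conjI ballI)
  fix W
  assume "W \<in> cover_prod I \<U>"
  then obtain U where "\<forall>i\<in>I. U i \<in> \<U> i" "W = Pi\<^sub>E I U"
    by (auto simp: cover_prod_def)
  then show "openin (product_topology X I) W"
    using assms by (auto simp: open_cover_def openin_PiE)
next
  show "\<Union> (cover_prod I \<U>) = topspace (product_topology X I)"
  proof (intro equalityI subsetI)
    fix f
    assume "f \<in> \<Union> (cover_prod I \<U>)"
    then obtain U where U: "\<forall>i\<in>I. U i \<in> \<U> i" "f \<in> Pi\<^sub>E I U"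
      by (auto simp: cover_prod_def)
    have "U i \<subseteq> topspace (X i)" if "i \<in> I" for i
      using assms(2)[OF that] U(1) that unfolding open_cover_def by blast
    then show "f \<in> topspace (product_topology X I)" using U(2) by (auto simp: PiE_iff)
  next
    fix f
    assume f: "f \<in> topspace (product_topology X I)"
    then have "\<forall>i\<in>I. \<exists>U. U \<in> \<U> i \<and> f i \<in> U"
      using assms(2) unfolding open_cover_def by (fastforce simp: PiE_iff)
    then obtain U where "\<forall>i\<in>I. U i \<in> \<U> i \<and> f i \<in> U i" by metis
    then have "Pi\<^sub>E I U \<in> cover_prod I \<U>" "f \<in> Pi\<^sub>E I U"
      using f by (auto simp: cover_prod_def PiE_iff)
    then show "f \<in> \<Union> (cover_prod I \<U>)" by blast
  qed
qed

lemma cover_number_prod_le: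
  assumes "finite I" and "\<And>i. i \<in> I \<Longrightarrow> compact_space (X i)"
    and "\<And>i. i \<in> I \<Longrightarrow> open_cover (X i) (\<U> i)"
  shows "cover_number (product_topology X I) (cover_prod I \<U>) \<le> (\<Prod>i\<in>I. cover_number (X i) (\<U> i))"
proof -
  have "\<forall>i\<in>I. \<exists>\<W>. \<W> \<subseteq> \<U> i \<and> finite \<W> \<and> card \<W> = cover_number (X i) (\<U> i) \<and>
      \<Union>\<W> = topspace (X i)"
    using cover_number_attained[OF assms(2,3)] by metis
  then obtain \<W> where \<W>: "\<And>i. i \<in> I \<Longrightarrow> \<W> i \<subseteq> \<U> i" "\<And>i. i \<in> I \<Longrightarrow> finite (\<W> i)"
    "\<And>i. i \<in> I \<Longrightarrow> card (\<W> i) = cover_number (X i) (\<U> i)"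
    "\<And>i. i \<in> I \<Longrightarrow> \<Union>(\<W> i) = topspace (X i)"
    by metis
  have fin: "finite (Pi\<^sub>E I \<W>)" using assms(1) \<W>(2) by (intro finite_PiE)
  have "topspace (product_topology X I) \<subseteq> \<Union>(Pi\<^sub>E I ` Pi\<^sub>E I \<W>)"
  proof
    fix f
    assume f: "f \<in> topspace (product_topology X I)"
    then have "\<forall>i\<in>I. \<exists>V. V \<in> \<W> i \<and> f i \<in> V" using \<W>(4) by (fastforce simp: PiE_iff)
    then obtain V where V: "\<forall>i\<in>I. V i \<in> \<W> i \<and> f i \<in> V i" by metis
    then have "restrict V I \<in> Pi\<^sub>E I \<W>" "f \<in> Pi\<^sub>E I (restrict V I)" using f by (auto simp: PiE_iff)
    then show "f \<in> \<Union>(Pi\<^sub>E I ` Pi\<^sub>E I \<W>)" by blast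
  qed
  moreover have "\<exists>U\<in>cover_prod I \<U>. W \<subseteq> U" if W: "W \<in> Pi\<^sub>E I ` Pi\<^sub>E I \<W>" for W
  proof -
    obtain V where V: "V \<in> Pi\<^sub>E I \<W>" "W = Pi\<^sub>E I V" using W by blast
    then have "\<forall>i\<in>I. V i \<in> \<U> i" using \<W>(1) by (meson PiE_mem subsetD)
    then have "W \<in> cover_prod I \<U>" using V(2) unfolding cover_prod_def by blast
    then show ?thesis by blast
  qed
  ultimately have "cover_number (product_topology X I) (cover_prod I \<U>) \<le> card (Pi\<^sub>E I ` Pi\<^sub>E I \<W>)"
    using fin by (intro cover_number_le_card open_cover_prod assms) auto
  also have "\<dots> \<le> card (Pi\<^sub>E I \<W>)" using fin by (rule card_image_le)
  also have "\<dots> = (\<Prod>i\<in>I. cover_number (X i) (\<U> i))"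
    using assms(1) \<W>(3) by (simp add: card_PiE)
  finally show ?thesis .
qed

text \<open>For one and the same family of covers this fails in general: minimal subcovers need not
  multiply.  Separated sets do multiply, at the price of passing to a star refinement.\<close>

lemma prod_cover_number_le:
  assumes "finite I" and "\<And>i. i \<in> I \<Longrightarrow> compact_space (X i)"
    and "\<And>i. i \<in> I \<Longrightarrow> open_cover (X i) (\<V> i)" and "\<And>i. i \<in> I \<Longrightarrow> open_cover (X i) (\<U> i)"
    and "\<And>i. i \<in> I \<Longrightarrow> star_refines (X i) (\<V> i) (\<U> i)"
  shows "(\<Prod>i\<in>I. cover_number (X i) (\<U> i)) \<le> cover_number (product_topology X I) (cover_prod I \<V>)"
proof -
  have "\<forall>i\<in>I. \<exists>E \<subseteq> topspace (X i). separated_by (\<V> i) E \<and> cover_number (X i) (\<U> i) \<le> card E"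
    using ex_separated_ge_cover_number[OF assms(2,3,4,5)] by metis
  then obtain E where E: "\<And>i. i \<in> I \<Longrightarrow> E i \<subseteq> topspace (X i)"
    "\<And>i. i \<in> I \<Longrightarrow> separated_by (\<V> i) (E i)"
    "\<And>i. i \<in> I \<Longrightarrow> cover_number (X i) (\<U> i) \<le> card (E i)"
    by metis
  have "(\<Prod>i\<in>I. cover_number (X i) (\<U> i)) \<le> (\<Prod>i\<in>I. card (E i))"
    by (rule prod_mono) (use E(3) in auto)
  also have "\<dots> = card (Pi\<^sub>E I E)" using assms(1) by (simp add: card_PiE)
  also have "\<dots> \<le> cover_number (product_topology X I) (cover_prod I \<V>)"
  proof (rule card_separated_le_cover_number(2))
    show "compact_space (product_topology X I)"
      using assms(2) by (simp add: compact_space_product_topology)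
    show "open_cover (product_topology X I) (cover_prod I \<V>)"
      using assms by (intro open_cover_prod)
    show "Pi\<^sub>E I E \<subseteq> topspace (product_topology X I)" using E(1) by (auto intro!: PiE_mono)
    \<comment> \<open>A box meets the product of the \<open>E i\<close> in at most one point because
      each of its sides meets \<open>E i\<close> in at most one.\<close>
    show "separated_by (cover_prod I \<V>) (Pi\<^sub>E I E)"
      unfolding separated_by_def
    proof (intro ballI)
      fix W f g
      assume "W \<in> cover_prod I \<V>" and fg: "f \<in> Pi\<^sub>E I E \<inter> W" "g \<in> Pi\<^sub>E I E \<inter> W"
      then obtain V where V: "\<forall>i\<in>I. V i \<in> \<V> i" "W = Pi\<^sub>E I V" by (auto simp: cover_prod_def)
      show "f = g"
      proof (rule PiE_ext)
        show "f \<in> Pi\<^sub>E I E" "g \<in> Pi\<^sub>E I E" using fg by auto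
        fix i
        assume "i \<in> I"
        then have "V i \<in> \<V> i" "f i \<in> E i \<inter> V i" "g i \<in> E i \<inter> V i"
          using fg V by (auto simp: PiE_iff)
        then show "f i = g i" using E(2)[OF \<open>i \<in> I\<close>] unfolding separated_by_def by blast
      qed
    qed
  qed
  finally show ?thesis .
qed

text \<open>Boxes intersect side by side, and sets for the pairs (j, i) can be chosen in either
  order. This turns a pattern in the product into a product of patterns. The \<open>topspace\<close>
  factor of \<open>cover_join\<close> keeps the identity valid for empty \<open>J\<close>.\<close>

lemma cover_join_prod:
  "cover_join (product_topology X I) J (\<lambda>j. cover_prod I (\<U> j)) =
   cover_prod I (\<lambda>i. cover_join (X i) J (\<lambda>j. \<U> j i))"
proof -
  have eq: "topspace (product_topology X I) \<inter> (\<Inter>j\<in>J. Pi\<^sub>E I (U j)) =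
      (\<Pi>\<^sub>E i\<in>I. topspace (X i) \<inter> (\<Inter>j\<in>J. U j i))" for U
    by (auto simp: PiE_iff)
  show ?thesis
  proof (intro equalityI subsetI)
    fix W
    assume "W \<in> cover_join (product_topology X I) J (\<lambda>j. cover_prod I (\<U> j))"
    then obtain A where A: "\<forall>j\<in>J. A j \<in> cover_prod I (\<U> j)"
      "W = topspace (product_topology X I) \<inter> (\<Inter>j\<in>J. A j)"
      unfolding cover_join_def by blast
    have "\<forall>j\<in>J. \<exists>U. (\<forall>i\<in>I. U i \<in> \<U> j i) \<and> A j = Pi\<^sub>E I U"
      using A(1) unfolding cover_prod_def by blast
    then obtain U where U: "\<And>j. j \<in> J \<Longrightarrow> \<forall>i\<in>I. U j i \<in> \<U> j i" "\<And>j. j \<in> J \<Longrightarrow> A j = Pi\<^sub>E I (U j)"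
      by metis
    have "W = (\<Pi>\<^sub>E i\<in>I. topspace (X i) \<inter> (\<Inter>j\<in>J. U j i))"
      unfolding A(2) eq[symmetric] using U(2) by simp
    moreover have "\<forall>i\<in>I. topspace (X i) \<inter> (\<Inter>j\<in>J. U j i) \<in> cover_join (X i) J (\<lambda>j. \<U> j i)"
      using U(1) unfolding cover_join_def by blast
    ultimately show "W \<in> cover_prod I (\<lambda>i. cover_join (X i) J (\<lambda>j. \<U> j i))"
      unfolding cover_prod_def by blast
  next
    fix W
    assume "W \<in> cover_prod I (\<lambda>i. cover_join (X i) J (\<lambda>j. \<U> j i))"
    then obtain A where A: "\<forall>i\<in>I. A i \<in> cover_join (X i) J (\<lambda>j. \<U> j i)" "W = Pi\<^sub>E I A"
      unfolding cover_prod_def by blast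
    have "\<forall>i\<in>I. \<exists>U. (\<forall>j\<in>J. U j \<in> \<U> j i) \<and> A i = topspace (X i) \<inter> (\<Inter>j\<in>J. U j)"
      using A(1) unfolding cover_join_def by blast
    then obtain U where U: "\<And>i. i \<in> I \<Longrightarrow> \<forall>j\<in>J. U i j \<in> \<U> j i"
      "\<And>i. i \<in> I \<Longrightarrow> A i = topspace (X i) \<inter> (\<Inter>j\<in>J. U i j)"
      by metis
    have "W = (\<Pi>\<^sub>E i\<in>I. topspace (X i) \<inter> (\<Inter>j\<in>J. U i j))"
      unfolding A(2) using U(2) by (intro PiE_cong) auto
    then have "W = topspace (product_topology X I) \<inter> (\<Inter>j\<in>J. \<Pi>\<^sub>E i\<in>I. U i j)"
      using eq[of "\<lambda>j i. U i j"] by simp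
    moreover have "\<forall>j\<in>J. (\<Pi>\<^sub>E i\<in>I. U i j) \<in> cover_prod I (\<U> j)"
      using U(1) unfolding cover_prod_def by blast
    ultimately show "W \<in> cover_join (product_topology X I) J (\<lambda>j. cover_prod I (\<U> j))"
      unfolding cover_join_def by blast
  qed
qed

text \<open>Compactness gives finitely many boxes inside members of \<W>, but their sides vary with
  the coordinate, whereas one cover \<U> has to serve all coordinates. Intersecting all sides
  through a point, from whichever coordinate they come, removes this dependence.\<close>

lemma ex_cover_prod_refinement:
  assumes "compact_space X" and "finite I" and "open_cover (product_topology (\<lambda>_. X) I) \<W>"
  obtains \<U> where "open_cover X \<U>" "\<And>V. V \<in> cover_prod I (\<lambda>_. \<U>) \<Longrightarrow> \<exists>W\<in>\<W>. V \<subseteq> W"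
proof -
  let ?P = "product_topology (\<lambda>_. X) I"
  have "\<exists>B W. (\<forall>i\<in>I. openin X (B i)) \<and> f \<in> Pi\<^sub>E I B \<and> Pi\<^sub>E I B \<subseteq> W \<and> W \<in> \<W>"
    if f: "f \<in> topspace ?P" for f
  proof -
    obtain W where W: "W \<in> \<W>" "f \<in> W" "openin ?P W"
      using assms(3) f unfolding open_cover_def by blast
    then show ?thesis unfolding openin_product_topology_alt by blast
  qed
  then obtain B W where B: "\<And>f i. f \<in> topspace ?P \<Longrightarrow> i \<in> I \<Longrightarrow> openin X (B f i)"
    "\<And>f. f \<in> topspace ?P \<Longrightarrow> f \<in> Pi\<^sub>E I (B f)"
    "\<And>f. f \<in> topspace ?P \<Longrightarrow> Pi\<^sub>E I (B f) \<subseteq> W f"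
    "\<And>f. f \<in> topspace ?P \<Longrightarrow> W f \<in> \<W>"
    by metis
  have "compactin ?P (topspace ?P)"
    using assms(1) unfolding compact_space_def[symmetric] compact_space_product_topology by blast
  moreover have "openin ?P V" if "V \<in> (\<lambda>f. Pi\<^sub>E I (B f)) ` topspace ?P" for V
    using that B(1) assms(2) by (auto simp: openin_PiE)
  moreover have "topspace ?P \<subseteq> \<Union>((\<lambda>f. Pi\<^sub>E I (B f)) ` topspace ?P)" using B(2) by blast
  ultimately obtain \<F> where \<F>: "finite \<F>" "\<F> \<subseteq> (\<lambda>f. Pi\<^sub>E I (B f)) ` topspace ?P"
    and cov: "topspace ?P \<subseteq> \<Union>\<F>"
    using compactinD[of ?P "topspace ?P" "(\<lambda>f. Pi\<^sub>E I (B f)) ` topspace ?P"] by blast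
  obtain F where F: "F \<subseteq> topspace ?P" "finite F" "\<F> = (\<lambda>f. Pi\<^sub>E I (B f)) ` F"
    using finite_subset_image[OF \<F>] by blast
  \<comment> \<open>The smallest open set around \<open>x\<close> that the finitely many sides \<open>B f i\<close> can cut out.\<close>
  define N where "N x = topspace X \<inter> \<Inter>{V \<in> case_prod B ` (F \<times> I). x \<in> V}" for x
  have "openin X (N x)" for x
  proof (cases "{V \<in> case_prod B ` (F \<times> I). x \<in> V} = {}")
    case False
    moreover have "finite {V \<in> case_prod B ` (F \<times> I). x \<in> V}" using F(2) assms(2) by simp
    ultimately have "openin X (\<Inter>{V \<in> case_prod B ` (F \<times> I). x \<in> V})"
      using B(1) F(1) by (intro openin_Inter) auto
    then show ?thesis unfolding N_def by blast
  qed (simp only: N_def, simp)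
  moreover have "x \<in> N x" if "x \<in> topspace X" for x using that by (auto simp: N_def)
  ultimately have "open_cover X (N ` topspace X)"
    unfolding open_cover_def by (auto simp: N_def)
  moreover have "\<exists>W\<in>\<W>. V \<subseteq> W" if V: "V \<in> cover_prod I (\<lambda>_. N ` topspace X)" for V
  proof -
    obtain U where U: "\<forall>i\<in>I. U i \<in> N ` topspace X" "V = Pi\<^sub>E I U"
      using V by (auto simp: cover_prod_def)
    have "\<forall>i\<in>I. \<exists>x. x \<in> topspace X \<and> U i = N x" using U(1) by blast
    then obtain x where x: "\<And>i. i \<in> I \<Longrightarrow> x i \<in> topspace X" "\<And>i. i \<in> I \<Longrightarrow> U i = N (x i)"
      by metis
    \<comment> \<open>The centres of the chosen neighbourhoods form a point of the product. One of
      the finitely many boxes contains it, and then contains the product of the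
      neighbourhoods.\<close>
    then have "restrict x I \<in> topspace ?P" by auto
    then obtain f where f: "f \<in> F" "restrict x I \<in> Pi\<^sub>E I (B f)" using cov F(3) by blast
    have "U i \<subseteq> B f i" if "i \<in> I" for i
    proof -
      have "x i \<in> B f i" using f(2) that by (auto simp: PiE_iff)
      then show ?thesis using x(2)[OF that] f(1) that by (auto simp: N_def)
    qed
    then have sub: "V \<subseteq> Pi\<^sub>E I (B f)" unfolding U(2) by (rule PiE_mono)
    have fP: "f \<in> topspace ?P" using f(1) F(1) by (rule subsetD[rotated])
    have "V \<subseteq> W f" using sub B(3)[OF fP] by (rule order_trans)
    then show ?thesis using B(4)[OF fP] by (rule bexI)
  qed
  ultimately show ?thesis by (rule that)
qed

subsection \<open>Pattern numbers\<close>

abbreviation pattern_join ::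
  "('g, 'm) monoid_scheme \<Rightarrow> 'x topology \<Rightarrow> ('g \<Rightarrow> 'x \<Rightarrow> 'x) \<Rightarrow> 'x set set \<Rightarrow> nat \<Rightarrow>
   (nat \<Rightarrow> 'g) \<Rightarrow> 'x set set" where
  "pattern_join G X \<alpha> \<U> n g \<equiv> cover_join X {1..n} (\<lambda>i. (\<lambda>U. \<alpha> (inv\<^bsub>G\<^esub> (g i)) ` U) ` \<U>)"

lemma tds_imp_group: "tds G X \<alpha> \<Longrightarrow> group G"
  by (simp add: tds_def group_action_def group_hom_def)

lemma tds_homeomorphic_map_inv:
  assumes "tds G X \<alpha>" and "g \<in> carrier G"
  shows "homeomorphic_map X X (\<alpha> (inv\<^bsub>G\<^esub> g))"
  using assms group.inv_closed[OF tds_imp_group[OF assms(1)] assms(2)] by (simp add: tds_def)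

lemma open_cover_pattern_join:
  assumes "tds G X \<alpha>" and "open_cover X \<U>" and "g \<in> {1..n} \<rightarrow> carrier G"
  shows "open_cover X (pattern_join G X \<alpha> \<U> n g)"
  using assms by (intro open_cover_join open_cover_translate tds_homeomorphic_map_inv[OF assms(1)]) auto

lemma pattern_number_le_power:
  assumes "tds G X \<alpha>" and "open_cover X \<U>" and "g \<in> {1..n} \<rightarrow> carrier G"
  shows "cover_number X (pattern_join G X \<alpha> \<U> n g) \<le> cover_number X \<U> ^ n"
proof -
  have cpt: "compact_space X" using assms(1) by (simp add: tds_def)
  have hm: "homeomorphic_map X X (\<alpha> (inv\<^bsub>G\<^esub> (g i)))" if "i \<in> {1..n}" for i
    using assms(3) that by (intro tds_homeomorphic_map_inv[OF assms(1)]) auto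
  have "cover_number X (pattern_join G X \<alpha> \<U> n g) \<le>
      (\<Prod>i\<in>{1..n}. cover_number X ((\<lambda>U. \<alpha> (inv\<^bsub>G\<^esub> (g i)) ` U) ` \<U>))"
    by (intro cover_number_join_le cpt open_cover_translate hm assms(2)) auto
  also have "\<dots> \<le> (\<Prod>i\<in>{1..n}. cover_number X \<U>)"
    by (intro prod_mono conjI cover_number_translate_le cpt hm assms(2)) auto
  finally show ?thesis by simp
qed

text \<open>There may be infinitely many tuples, but their cover numbers share the bound
  \<open>cover_number X \<U> ^ n\<close>; thus \<open>Max\<close> is a true maximum.\<close>

lemma finite_pattern_numbers:
  assumes "tds G X \<alpha>" and "open_cover X \<U>"
  shows "finite {cover_number X (pattern_join G X \<alpha> \<U> n g) | g. g \<in> {1..n} \<rightarrow>\<^sub>E carrier G}"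
  by (rule finite_subset[of _ "{..cover_number X \<U> ^ n}"])
    (use pattern_number_le_power[OF assms] in \<open>auto simp: PiE_def\<close>)

lemma pattern_number_le_max:
  assumes "tds G X \<alpha>" and "open_cover X \<U>" and "g \<in> {1..n} \<rightarrow> carrier G"
  shows "cover_number X (pattern_join G X \<alpha> \<U> n g) \<le> max_pattern_number G X \<alpha> \<U> n"
proof -
  \<comment> \<open>\<open>max_pattern_number\<close> ranges over extensional tuples, while the join
    looks only at indices in \<open>{1..n}\<close>.\<close>
  have "pattern_join G X \<alpha> \<U> n g = pattern_join G X \<alpha> \<U> n (restrict g {1..n})"
    by (rule cover_join_cong) simp
  moreover have "restrict g {1..n} \<in> {1..n} \<rightarrow>\<^sub>E carrier G" using assms(3) by auto
  ultimately have "cover_number X (pattern_join G X \<alpha> \<U> n g) \<in>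
      {cover_number X (pattern_join G X \<alpha> \<U> n g) | g. g \<in> {1..n} \<rightarrow>\<^sub>E carrier G}"
    by (intro CollectI exI[of _ "restrict g {1..n}"] conjI) (simp_all only:)
  then show ?thesis
    unfolding max_pattern_number_def by (rule Max_ge[OF finite_pattern_numbers[OF assms(1,2)]])
qed

lemma max_pattern_number_attained:
  assumes "tds G X \<alpha>" and "open_cover X \<U>"
  obtains g where "g \<in> {1..n} \<rightarrow> carrier G"
    "max_pattern_number G X \<alpha> \<U> n = cover_number X (pattern_join G X \<alpha> \<U> n g)"
proof -
  let ?S = "{cover_number X (pattern_join G X \<alpha> \<U> n g) | g. g \<in> {1..n} \<rightarrow>\<^sub>E carrier G}"
  have "\<one>\<^bsub>G\<^esub> \<in> carrier G"
    using tds_imp_group[OF assms(1)] by (simp add: group.is_monoid monoid.one_closed)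
  then have "(\<lambda>i\<in>{1..n}. \<one>\<^bsub>G\<^esub>) \<in> {1..n} \<rightarrow>\<^sub>E carrier G" by auto
  then have "?S \<noteq> {}" by blast
  then have "Max ?S \<in> ?S" using finite_pattern_numbers[OF assms] by (intro Max_in)
  then obtain g where "g \<in> {1..n} \<rightarrow>\<^sub>E carrier G"
    "Max ?S = cover_number X (pattern_join G X \<alpha> \<U> n g)"
    by blast
  then show ?thesis using that[of g] by (auto simp: max_pattern_number_def PiE_def)
qed

text \<open>An optimal tuple of length m + n splits into two blocks, each of which does at most as
  well as the best tuple of its length.\<close>

lemma max_pattern_number_add_le:
  assumes "tds G X \<alpha>" and "open_cover X \<U>"
  shows "max_pattern_number G X \<alpha> \<U> (m + n) \<le>
         max_pattern_number G X \<alpha> \<U> m * max_pattern_number G X \<alpha> \<U> n"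
proof -
  have cpt: "compact_space X" using assms(1) by (simp add: tds_def)
  obtain g where g: "g \<in> {1..m + n} \<rightarrow> carrier G"
    "max_pattern_number G X \<alpha> \<U> (m + n) = cover_number X (pattern_join G X \<alpha> \<U> (m + n) g)"
    using max_pattern_number_attained[OF assms] .
  let ?T = "\<lambda>i. (\<lambda>U. \<alpha> (inv\<^bsub>G\<^esub> (g i)) ` U) ` \<U>"
  have split: "{1..m + n} = {1..m} \<union> {m + 1..m + n}" by auto
  have bij: "bij_betw (\<lambda>i. i + m) {1..n} {m + 1..m + n}"
    by (rule bij_betwI[of _ _ _ "\<lambda>i. i - m"]) auto
  have "max_pattern_number G X \<alpha> \<U> (m + n) \<le>
      cover_number X (cover_join X {1..m} ?T) * cover_number X (cover_join X {m + 1..m + n} ?T)"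
    unfolding g(2) split
    using g(1) assms(2)
    by (intro cover_number_join_Un_le cpt open_cover_translate
        tds_homeomorphic_map_inv[OF assms(1)]) auto
  also have "cover_join X {m + 1..m + n} ?T = pattern_join G X \<alpha> \<U> n (\<lambda>i. g (i + m))"
    by (rule cover_join_reindex[OF bij])
  also have "cover_number X (cover_join X {1..m} ?T) *
      cover_number X (pattern_join G X \<alpha> \<U> n (\<lambda>i. g (i + m))) \<le>
      max_pattern_number G X \<alpha> \<U> m * max_pattern_number G X \<alpha> \<U> n"
    using g(1) by (intro mult_le_mono pattern_number_le_max assms) auto
  finally show ?thesis .
qed

section \<open>Exponential growth rates of pattern numbers\<close>

text \<open>Relies on \<open>ln 0 = 0\<close>, which also makes the logarithm of every natural
  number nonnegative. An open cover of a compact space has cover number 0 exactly when the space is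
  empty.\<close>

lemma ln_real_nat_mono: "m \<le> n \<Longrightarrow> ln (real m) \<le> ln (real n)"
  by (cases "m = 0"; cases "n = 0") auto

lemma ln_real_nat_power: "ln (real (m ^ k)) = real k * ln (real m)"
  by (cases "m = 0"; cases "k = 0") (auto simp: ln_realpow)

text \<open>The \<open>lim\<close> in the definition is meaningful only once convergence is known;
  logarithms turn submultiplicativity of the pattern numbers into subadditivity.\<close>

lemma pattern_entropy_cover_LIMSEQ:
  assumes "tds G X \<alpha>" and "open_cover X \<U>"
  shows "(\<lambda>n. 1 / real n * ln (real (max_pattern_number G X \<alpha> \<U> n)))
           \<longlonglongrightarrow> pattern_entropy_cover G X \<alpha> \<U>"
proof -
  let ?p = "max_pattern_number G X \<alpha> \<U>"
  have "ln (real (?p (m + n))) \<le> ln (real (?p m)) + ln (real (?p n))" for m n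
  \<comment> \<open>\<open>ln_mult\<close> needs nonzero factors; if one vanishes,
    submultiplicativity makes the left-hand side \<open>ln 0 = 0\<close>.\<close>
  proof (cases "?p m = 0 \<or> ?p n = 0")
    case True
    then have "?p (m + n) = 0" using max_pattern_number_add_le[OF assms, of m n] by auto
    then show ?thesis using ln_real_nat_mono[of 0 "?p m"] ln_real_nat_mono[of 0 "?p n"] by simp
  next
    case False
    have "ln (real (?p (m + n))) \<le> ln (real (?p m * ?p n))"
      by (rule ln_real_nat_mono[OF max_pattern_number_add_le[OF assms]])
    then show ?thesis using False by (simp add: ln_mult)
  qed
  moreover have "0 \<le> ln (real (?p n))" for n using ln_real_nat_mono[of 0 "?p n"] by simp
  ultimately have "convergent (\<lambda>n. 1 / real n * ln (real (?p n)))"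
    by (rule subadditive_convergent)
  then show ?thesis unfolding pattern_entropy_cover_def by (simp add: convergent_LIMSEQ_iff)
qed

lemma pattern_entropy_cover_nonneg:
  assumes "tds G X \<alpha>" and "open_cover X \<U>"
  shows "0 \<le> pattern_entropy_cover G X \<alpha> \<U>"
proof (rule LIMSEQ_le_const[OF pattern_entropy_cover_LIMSEQ[OF assms]])
  have "0 \<le> 1 / real n * ln (real (max_pattern_number G X \<alpha> \<U> n))" for n
    using ln_real_nat_mono[of 0 "max_pattern_number G X \<alpha> \<U> n"] by simp
  then show "\<exists>N. \<forall>n\<ge>N. 0 \<le> 1 / real n * ln (real (max_pattern_number G X \<alpha> \<U> n))" by blast
qed

text \<open>The exponent k is the same for all n, so it passes through the logarithm and the limit
  as a factor.\<close>

lemma pattern_entropy_cover_le_mult: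
  assumes "tds G X \<alpha>" "open_cover X \<U>" and "tds G' X' \<alpha>'" "open_cover X' \<U>'"
    and "\<And>n. max_pattern_number G X \<alpha> \<U> n \<le> max_pattern_number G' X' \<alpha>' \<U>' n ^ k"
  shows "pattern_entropy_cover G X \<alpha> \<U> \<le> real k * pattern_entropy_cover G' X' \<alpha>' \<U>'"
proof (rule LIMSEQ_le[OF pattern_entropy_cover_LIMSEQ[OF assms(1,2)]
      tendsto_mult_left[OF pattern_entropy_cover_LIMSEQ[OF assms(3,4)], of "real k"]])
  \<comment> \<open>For n = 0 both sides are 0, since \<open>1 / real 0 = 0\<close>.\<close>
  have "1 / real n * ln (real (max_pattern_number G X \<alpha> \<U> n)) \<le>
      real k * (1 / real n * ln (real (max_pattern_number G' X' \<alpha>' \<U>' n)))" for n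
    using ln_real_nat_mono[OF assms(5)[of n]]
    by (cases "n = 0") (simp_all add: ln_real_nat_power divide_right_mono del: of_nat_power)
  then show "\<exists>N. \<forall>n\<ge>N. 1 / real n * ln (real (max_pattern_number G X \<alpha> \<U> n)) \<le>
      real k * (1 / real n * ln (real (max_pattern_number G' X' \<alpha>' \<U>' n)))"
    by blast
qed

lemma pattern_entropy_cover_mult_le:
  assumes "tds G X \<alpha>" "open_cover X \<U>" and "tds G' X' \<alpha>'" "open_cover X' \<U>'"
    and "\<And>n. max_pattern_number G X \<alpha> \<U> n ^ k \<le> max_pattern_number G' X' \<alpha>' \<U>' n"
  shows "real k * pattern_entropy_cover G X \<alpha> \<U> \<le> pattern_entropy_cover G' X' \<alpha>' \<U>'"
proof (rule LIMSEQ_le[OF tendsto_mult_left[OF pattern_entropy_cover_LIMSEQ[OF assms(1,2)]]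
      pattern_entropy_cover_LIMSEQ[OF assms(3,4)]])
  have "real k * (1 / real n * ln (real (max_pattern_number G X \<alpha> \<U> n))) \<le>
      1 / real n * ln (real (max_pattern_number G' X' \<alpha>' \<U>' n))" for n
    using ln_real_nat_mono[OF assms(5)[of n]]
    by (cases "n = 0") (simp_all add: ln_real_nat_power divide_right_mono del: of_nat_power)
  then show "\<exists>N. \<forall>n\<ge>N. real k * (1 / real n * ln (real (max_pattern_number G X \<alpha> \<U> n))) \<le>
      1 / real n * ln (real (max_pattern_number G' X' \<alpha>' \<U>' n))"
    by blast
qed

text \<open>Images and intersections are monotone, so a refinement chosen member by member survives
  translation and join along the same tuple.\<close>

lemma cover_number_pattern_join_refine:
  assumes "tds G X \<alpha>" and "open_cover X \<U>" and "open_cover X \<V>"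
    and "\<And>V. V \<in> \<V> \<Longrightarrow> \<exists>U\<in>\<U>. V \<subseteq> U" and "g \<in> {1..n} \<rightarrow> carrier G"
  shows "cover_number X (pattern_join G X \<alpha> \<U> n g) \<le> cover_number X (pattern_join G X \<alpha> \<V> n g)"
proof (rule cover_number_refine)
  let ?b = "\<lambda>i. \<alpha> (inv\<^bsub>G\<^esub> (g i))"
  obtain \<phi> where \<phi>: "\<And>V. V \<in> \<V> \<Longrightarrow> \<phi> V \<in> \<U> \<and> V \<subseteq> \<phi> V" using assms(4) by metis
  fix W
  assume "W \<in> pattern_join G X \<alpha> \<V> n g"
  then obtain A where A: "\<forall>i\<in>{1..n}. A i \<in> (\<lambda>V. ?b i ` V) ` \<V>"
    "W = topspace X \<inter> (\<Inter>i\<in>{1..n}. A i)"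
    unfolding cover_join_def by blast
  have "\<forall>i\<in>{1..n}. \<exists>V. V \<in> \<V> \<and> A i = ?b i ` V" using A(1) by blast
  then obtain V where V: "\<And>i. i \<in> {1..n} \<Longrightarrow> V i \<in> \<V>" "\<And>i. i \<in> {1..n} \<Longrightarrow> A i = ?b i ` V i"
    by metis
  let ?U = "topspace X \<inter> (\<Inter>i\<in>{1..n}. ?b i ` \<phi> (V i))"
  have "?U \<in> pattern_join G X \<alpha> \<U> n g"
    unfolding cover_join_def using V(1) \<phi> by (intro CollectI exI[of _ "\<lambda>i. ?b i ` \<phi> (V i)"]) auto
  moreover have "A i \<subseteq> ?b i ` \<phi> (V i)" if "i \<in> {1..n}" for i
    using V[OF that] \<phi> by (simp add: image_mono)
  then have "W \<subseteq> ?U" unfolding A(2) by blast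
  ultimately show "\<exists>U\<in>pattern_join G X \<alpha> \<U> n g. W \<subseteq> U" by blast
next
  show "compact_space X" using assms(1) by (simp add: tds_def)
  show "open_cover X (pattern_join G X \<alpha> \<U> n g)" "open_cover X (pattern_join G X \<alpha> \<V> n g)"
    by (rule open_cover_pattern_join[OF assms(1) _ assms(5)], rule assms)+
qed

subsection \<open>The co-induced system\<close>

text \<open>Right translation by g permutes the cosets, so the action permutes the sides of a box
  and moves each by a cocycle element. The sides lie in the space because
  \<open>coind_action\<close> is \<open>undefined\<close> on functions outside the product.\<close>

lemma coind_action_image_PiE:
  assumes "group G" and "subgroup H G" and "coset_section G H s" and g: "g \<in> carrier G"
    and U: "\<And>\<theta>. \<theta> \<in> rcosets\<^bsub>G\<^esub> H \<Longrightarrow> U \<theta> \<subseteq> topspace X"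
  shows "coind_action G H s X \<alpha> g ` Pi\<^sub>E (rcosets\<^bsub>G\<^esub> H) U =
    (\<Pi>\<^sub>E \<theta>\<in>rcosets\<^bsub>G\<^esub> H.
      \<alpha> (s \<theta> \<otimes>\<^bsub>G\<^esub> g \<otimes>\<^bsub>G\<^esub> inv\<^bsub>G\<^esub> (s (\<theta> #>\<^bsub>G\<^esub> g))) ` U (\<theta> #>\<^bsub>G\<^esub> g))"
    (is "_ = Pi\<^sub>E ?R (\<lambda>\<theta>. \<alpha> (?c \<theta>) ` U (\<theta> #>\<^bsub>G\<^esub> g))")
proof -
  interpret group G by fact
  note cos = coset_section_cocycle(1)[OF assms(1-3)]
  have sub: "\<theta> \<subseteq> carrier G" if "\<theta> \<in> ?R" for \<theta>
    using that rcosets_subset_PowG[OF assms(2)] by auto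
  have ret: "\<theta> #>\<^bsub>G\<^esub> inv\<^bsub>G\<^esub> g #>\<^bsub>G\<^esub> g = \<theta>" if "\<theta> \<in> ?R" for \<theta>
    using sub[OF that] g by (simp add: coset_mult_assoc)
  have forth: "\<theta> #>\<^bsub>G\<^esub> g #>\<^bsub>G\<^esub> inv\<^bsub>G\<^esub> g = \<theta>" if "\<theta> \<in> ?R" for \<theta>
    using sub[OF that] g by (simp add: coset_mult_assoc)
  have act: "coind_action G H s X \<alpha> g f = (\<lambda>\<theta>\<in>?R. \<alpha> (?c \<theta>) (f (\<theta> #>\<^bsub>G\<^esub> g)))"
    if "f \<in> Pi\<^sub>E ?R U" for f
  proof -
    have "f \<in> topspace (coind_space G H X)"
      using that PiE_mono[of ?R U "\<lambda>_. topspace X"] U by (auto simp: coind_space_def)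
    then show ?thesis by (simp add: coind_action_def)
  qed
  show ?thesis
  proof (intro equalityI subsetI)
    fix k
    assume "k \<in> coind_action G H s X \<alpha> g ` Pi\<^sub>E ?R U"
    then obtain f where f: "f \<in> Pi\<^sub>E ?R U" "k = coind_action G H s X \<alpha> g f" by blast
    have "f (\<theta> #>\<^bsub>G\<^esub> g) \<in> U (\<theta> #>\<^bsub>G\<^esub> g)" if "\<theta> \<in> ?R" for \<theta>
      using f(1) cos[OF that g] by (rule PiE_mem)
    then show "k \<in> Pi\<^sub>E ?R (\<lambda>\<theta>. \<alpha> (?c \<theta>) ` U (\<theta> #>\<^bsub>G\<^esub> g))"
      unfolding f(2) act[OF f(1)] by (simp add: PiE_iff)
  next
    fix k
    assume k: "k \<in> Pi\<^sub>E ?R (\<lambda>\<theta>. \<alpha> (?c \<theta>) ` U (\<theta> #>\<^bsub>G\<^esub> g))"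
    then have "\<forall>\<theta>\<in>?R. \<exists>x. x \<in> U (\<theta> #>\<^bsub>G\<^esub> g) \<and> k \<theta> = \<alpha> (?c \<theta>) x" by (auto simp: PiE_iff)
    then obtain x where x: "\<And>\<theta>. \<theta> \<in> ?R \<Longrightarrow> x \<theta> \<in> U (\<theta> #>\<^bsub>G\<^esub> g)"
      "\<And>\<theta>. \<theta> \<in> ?R \<Longrightarrow> k \<theta> = \<alpha> (?c \<theta>) (x \<theta>)"
      by metis
    \<comment> \<open>Coordinate \<theta> of the image reads coordinate \<theta>g of the argument,
      so the preimage is assembled along translation by the inverse of g.\<close>
    define f where "f = (\<lambda>\<theta>\<in>?R. x (\<theta> #>\<^bsub>G\<^esub> inv\<^bsub>G\<^esub> g))"
    have "x (\<theta> #>\<^bsub>G\<^esub> inv\<^bsub>G\<^esub> g) \<in> U \<theta>" if "\<theta> \<in> ?R" for \<theta>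
      using x(1)[OF cos[OF that inv_closed[OF g]]] ret[OF that] by simp
    then have f: "f \<in> Pi\<^sub>E ?R U" by (simp add: f_def)
    have "coind_action G H s X \<alpha> g f = k"
    proof (rule extensionalityI[of _ ?R])
      show "k \<in> extensional ?R" using k by (simp add: PiE_iff)
      fix \<theta>
      assume "\<theta> \<in> ?R"
      then show "coind_action G H s X \<alpha> g f \<theta> = k \<theta>"
        unfolding act[OF f] using x(2) forth cos g by (simp add: f_def)
    qed (simp add: act[OF f])
    then show "k \<in> coind_action G H s X \<alpha> g ` Pi\<^sub>E ?R U" using f by blast
  qed
qed

text \<open>All coordinates carry the same cover \<U>, so the permutation of coordinates leaves no
  trace; only the translation by the cocycle remains.\<close>

lemma coind_action_cover_prod:
  assumes "group G" and "subgroup H G" and "coset_section G H s" and g: "g \<in> carrier G"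
    and U: "open_cover X \<U>"
  shows "(\<lambda>W. coind_action G H s X \<alpha> g ` W) ` cover_prod (rcosets\<^bsub>G\<^esub> H) (\<lambda>_. \<U>) =
    cover_prod (rcosets\<^bsub>G\<^esub> H)
      (\<lambda>\<theta>. (\<lambda>U. \<alpha> (s \<theta> \<otimes>\<^bsub>G\<^esub> g \<otimes>\<^bsub>G\<^esub> inv\<^bsub>G\<^esub> (s (\<theta> #>\<^bsub>G\<^esub> g))) ` U) ` \<U>)"
    (is "_ = cover_prod ?R (\<lambda>\<theta>. (\<lambda>U. \<alpha> (?c \<theta>) ` U) ` \<U>)")
proof -
  interpret group G by fact
  note cos = coset_section_cocycle(1)[OF assms(1-3)]
  have sub: "\<theta> \<subseteq> carrier G" if "\<theta> \<in> ?R" for \<theta>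
    using that rcosets_subset_PowG[OF assms(2)] by auto
  have forth: "\<theta> #>\<^bsub>G\<^esub> g #>\<^bsub>G\<^esub> inv\<^bsub>G\<^esub> g = \<theta>" if "\<theta> \<in> ?R" for \<theta>
    using sub[OF that] g by (simp add: coset_mult_assoc)
  have img: "coind_action G H s X \<alpha> g ` Pi\<^sub>E ?R V = Pi\<^sub>E ?R (\<lambda>\<theta>. \<alpha> (?c \<theta>) ` V (\<theta> #>\<^bsub>G\<^esub> g))"
    if "\<forall>\<theta>\<in>?R. V \<theta> \<in> \<U>" for V
    using that U by (intro coind_action_image_PiE assms) (auto simp: open_cover_def)
  show ?thesis
  proof (intro equalityI subsetI)
    fix W
    assume "W \<in> (\<lambda>W. coind_action G H s X \<alpha> g ` W) ` cover_prod ?R (\<lambda>_. \<U>)"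
    then obtain V where V: "\<forall>\<theta>\<in>?R. V \<theta> \<in> \<U>" "W = coind_action G H s X \<alpha> g ` Pi\<^sub>E ?R V"
      by (auto simp: cover_prod_def)
    then have "W = Pi\<^sub>E ?R (\<lambda>\<theta>. \<alpha> (?c \<theta>) ` V (\<theta> #>\<^bsub>G\<^esub> g))" by (simp only: img)
    moreover have "\<forall>\<theta>\<in>?R. \<alpha> (?c \<theta>) ` V (\<theta> #>\<^bsub>G\<^esub> g) \<in> (\<lambda>U. \<alpha> (?c \<theta>) ` U) ` \<U>"
      using V(1) cos[OF _ g] by blast
    ultimately show "W \<in> cover_prod ?R (\<lambda>\<theta>. (\<lambda>U. \<alpha> (?c \<theta>) ` U) ` \<U>)"
      unfolding cover_prod_def by blast
  next
    fix W
    assume "W \<in> cover_prod ?R (\<lambda>\<theta>. (\<lambda>U. \<alpha> (?c \<theta>) ` U) ` \<U>)"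
    then obtain A where A: "\<forall>\<theta>\<in>?R. A \<theta> \<in> (\<lambda>U. \<alpha> (?c \<theta>) ` U) ` \<U>" "W = Pi\<^sub>E ?R A"
      unfolding cover_prod_def by blast
    have "\<forall>\<theta>\<in>?R. \<exists>V. V \<in> \<U> \<and> A \<theta> = \<alpha> (?c \<theta>) ` V" using A(1) by blast
    then obtain V where V: "\<And>\<theta>. \<theta> \<in> ?R \<Longrightarrow> V \<theta> \<in> \<U>" "\<And>\<theta>. \<theta> \<in> ?R \<Longrightarrow> A \<theta> = \<alpha> (?c \<theta>) ` V \<theta>"
      by metis
    define V' where "V' \<theta> = V (\<theta> #>\<^bsub>G\<^esub> inv\<^bsub>G\<^esub> g)" for \<theta>
    have V': "\<forall>\<theta>\<in>?R. V' \<theta> \<in> \<U>" using V(1) cos g by (simp add: V'_def)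
    have "W = Pi\<^sub>E ?R (\<lambda>\<theta>. \<alpha> (?c \<theta>) ` V' (\<theta> #>\<^bsub>G\<^esub> g))"
      unfolding A(2) by (rule PiE_cong) (use V(2) forth in \<open>simp add: V'_def\<close>)
    then have "W = coind_action G H s X \<alpha> g ` Pi\<^sub>E ?R V'" by (simp only: img[OF V'])
    then show "W \<in> (\<lambda>W. coind_action G H s X \<alpha> g ` W) ` cover_prod ?R (\<lambda>_. \<U>)"
      using V' unfolding cover_prod_def by blast
  qed
qed

lemma coind_pattern_join:
  assumes "group G" and "subgroup H G" and "coset_section G H s" and "g \<in> {1..n} \<rightarrow> carrier G"
    and "open_cover X \<U>"
  shows "pattern_join G (coind_space G H X) (coind_action G H s X \<alpha>)
      (cover_prod (rcosets\<^bsub>G\<^esub> H) (\<lambda>_. \<U>)) n g =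
    cover_prod (rcosets\<^bsub>G\<^esub> H) (\<lambda>\<theta>. cover_join X {1..n} (\<lambda>i.
      (\<lambda>U. \<alpha> (s \<theta> \<otimes>\<^bsub>G\<^esub> inv\<^bsub>G\<^esub> (g i) \<otimes>\<^bsub>G\<^esub> inv\<^bsub>G\<^esub> (s (\<theta> #>\<^bsub>G\<^esub> inv\<^bsub>G\<^esub> (g i)))) ` U) ` \<U>))"
  unfolding coind_space_def cover_join_prod[symmetric]
proof (rule cover_join_cong, rule coind_action_cover_prod[OF assms(1-3) _ assms(5)])
  fix i
  assume "i \<in> {1..n}"
  then show "inv\<^bsub>G\<^esub> (g i) \<in> carrier G"
    using assms(4) by (intro group.inv_closed[OF assms(1)]) (rule Pi_mem)
qed

text \<open>Each coset has its own tuple of cocycle elements in H, yet all these patterns are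
  bounded by the same maximum, so the product over the cosets is bounded by a power.\<close>

lemma max_pattern_number_coind_le:
  assumes "group G" and "countable (carrier G)" and "subgroup H G"
    and fin: "finite (rcosets\<^bsub>G\<^esub> H)" and X: "tds (G\<lparr>carrier := H\<rparr>) X \<alpha>"
    and s: "coset_section G H s" and U: "open_cover X \<U>"
    and W: "open_cover (coind_space G H X) \<W>"
    and ref: "\<And>V. V \<in> cover_prod (rcosets\<^bsub>G\<^esub> H) (\<lambda>_. \<U>) \<Longrightarrow> \<exists>W\<in>\<W>. V \<subseteq> W"
  shows "max_pattern_number G (coind_space G H X) (coind_action G H s X \<alpha>) \<W> n \<le>
         max_pattern_number (G\<lparr>carrier := H\<rparr>) X \<alpha> \<U> n ^ card (rcosets\<^bsub>G\<^esub> H)"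
proof -
  interpret group G by fact
  let ?R = "rcosets\<^bsub>G\<^esub> H" and ?P = "coind_space G H X" and ?\<beta> = "coind_action G H s X \<alpha>"
    and ?H = "G\<lparr>carrier := H\<rparr>"
  let ?c = "\<lambda>\<theta> g. s \<theta> \<otimes>\<^bsub>G\<^esub> g \<otimes>\<^bsub>G\<^esub> inv\<^bsub>G\<^esub> (s (\<theta> #>\<^bsub>G\<^esub> g))"
  have P: "tds G ?P ?\<beta>" using assms by (intro tds_coind)
  have cpt: "compact_space X" using X by (simp add: tds_def)
  obtain g where g: "g \<in> {1..n} \<rightarrow> carrier G"
    "max_pattern_number G ?P ?\<beta> \<W> n = cover_number ?P (pattern_join G ?P ?\<beta> \<W> n g)"
    using max_pattern_number_attained[OF P W] .
  have c: "?c \<theta> (inv\<^bsub>G\<^esub> (g i)) \<in> H" if "\<theta> \<in> ?R" "i \<in> {1..n}" for \<theta> i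
    using Pi_mem[OF g(1) that(2)] by (intro coset_section_cocycle(4)[OF assms(1,3) s that(1)]) simp
  have prodU: "open_cover ?P (cover_prod ?R (\<lambda>_. \<U>))"
    unfolding coind_space_def using fin U by (intro open_cover_prod)
  \<comment> \<open>Patterns translate by inverses, so the tuple in H consists of inverted cocycle
    elements; inverses in the subgroup and in G agree.\<close>
  have join: "cover_join X {1..n} (\<lambda>i. (\<lambda>U. \<alpha> (?c \<theta> (inv\<^bsub>G\<^esub> (g i))) ` U) ` \<U>) =
      pattern_join ?H X \<alpha> \<U> n (\<lambda>i. inv\<^bsub>G\<^esub> (?c \<theta> (inv\<^bsub>G\<^esub> (g i))))" if "\<theta> \<in> ?R" for \<theta>
  proof (rule cover_join_cong)
    fix i
    assume "i \<in> {1..n}"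
    then have "inv\<^bsub>?H\<^esub> (inv\<^bsub>G\<^esub> (?c \<theta> (inv\<^bsub>G\<^esub> (g i)))) = ?c \<theta> (inv\<^bsub>G\<^esub> (g i))"
      using c[OF that] assms(3)
      by (metis inv_inv m_inv_consistent subgroup.m_inv_closed subgroup.mem_carrier)
    then show "(\<lambda>U. \<alpha> (?c \<theta> (inv\<^bsub>G\<^esub> (g i))) ` U) ` \<U> =
        (\<lambda>U. \<alpha> (inv\<^bsub>?H\<^esub> (inv\<^bsub>G\<^esub> (?c \<theta> (inv\<^bsub>G\<^esub> (g i))))) ` U) ` \<U>"
      by (simp only:)
  qed
  have inH: "(\<lambda>i. inv\<^bsub>G\<^esub> (?c \<theta> (inv\<^bsub>G\<^esub> (g i)))) \<in> {1..n} \<rightarrow> carrier ?H" if "\<theta> \<in> ?R" for \<theta>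
    using c[OF that] subgroup.m_inv_closed[OF assms(3)] by auto
  have "max_pattern_number G ?P ?\<beta> \<W> n \<le>
      cover_number ?P (pattern_join G ?P ?\<beta> (cover_prod ?R (\<lambda>_. \<U>)) n g)"
    unfolding g(2) by (rule cover_number_pattern_join_refine[OF P W prodU ref g(1)])
  also have "\<dots> = cover_number (product_topology (\<lambda>_. X) ?R)
      (cover_prod ?R (\<lambda>\<theta>. cover_join X {1..n} (\<lambda>i. (\<lambda>U. \<alpha> (?c \<theta> (inv\<^bsub>G\<^esub> (g i))) ` U) ` \<U>)))"
    by (subst coind_pattern_join[OF assms(1,3) s g(1) U]) (simp add: coind_space_def)
  also have "\<dots> \<le> (\<Prod>\<theta>\<in>?R. cover_number X
      (cover_join X {1..n} (\<lambda>i. (\<lambda>U. \<alpha> (?c \<theta> (inv\<^bsub>G\<^esub> (g i))) ` U) ` \<U>)))"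
  proof (rule cover_number_prod_le[OF fin cpt])
    fix \<theta>
    assume "\<theta> \<in> ?R"
    then show "open_cover X (cover_join X {1..n} (\<lambda>i. (\<lambda>U. \<alpha> (?c \<theta> (inv\<^bsub>G\<^esub> (g i))) ` U) ` \<U>))"
      unfolding join[OF \<open>\<theta> \<in> ?R\<close>] by (intro open_cover_pattern_join[OF X U] inH)
  qed
  also have "\<dots> \<le> (\<Prod>\<theta>\<in>?R. max_pattern_number ?H X \<alpha> \<U> n)"
  proof (intro prod_mono conjI)
    fix \<theta>
    assume "\<theta> \<in> ?R"
    then show "cover_number X (cover_join X {1..n} (\<lambda>i. (\<lambda>U. \<alpha> (?c \<theta> (inv\<^bsub>G\<^esub> (g i))) ` U) ` \<U>))
        \<le> max_pattern_number ?H X \<alpha> \<U> n"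
      unfolding join[OF \<open>\<theta> \<in> ?R\<close>] by (intro pattern_number_le_max[OF X U] inH)
  qed simp
  finally show ?thesis by simp
qed

text \<open>A central subgroup fixes every coset and its cocycle is trivial, so it acts diagonally.\<close>

lemma central_cocycle:
  assumes "group G" and "subgroup H G" and "H \<subseteq> group_center G" and "coset_section G H s"
    and "\<theta> \<in> rcosets\<^bsub>G\<^esub> H" and "h \<in> H"
  shows "s \<theta> \<otimes>\<^bsub>G\<^esub> h \<otimes>\<^bsub>G\<^esub> inv\<^bsub>G\<^esub> (s (\<theta> #>\<^bsub>G\<^esub> h)) = h"
proof -
  interpret group G by fact
  have h: "h \<in> carrier G" "\<And>x. x \<in> carrier G \<Longrightarrow> h \<otimes>\<^bsub>G\<^esub> x = x \<otimes>\<^bsub>G\<^esub> h"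
    using assms(3,6) by (auto simp: group_center_def)
  obtain a where a: "a \<in> carrier G" "\<theta> = H #>\<^bsub>G\<^esub> a"
    using assms(5) by (auto simp: RCOSETS_def)
  have "\<theta> #>\<^bsub>G\<^esub> h = H #>\<^bsub>G\<^esub> (a \<otimes>\<^bsub>G\<^esub> h)"
    using a h(1) assms(2) by (simp add: coset_mult_assoc subgroup.subset)
  \<comment> \<open>Centrality moves \<open>h\<close> to the left of the representative, where H
    absorbs it.\<close>
  also have "a \<otimes>\<^bsub>G\<^esub> h = h \<otimes>\<^bsub>G\<^esub> a" using h(2)[OF a(1)] by simp
  also have "H #>\<^bsub>G\<^esub> (h \<otimes>\<^bsub>G\<^esub> a) = H #>\<^bsub>G\<^esub> h #>\<^bsub>G\<^esub> a"
    using a h(1) assms(2) by (simp add: coset_mult_assoc subgroup.subset)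
  also have "\<dots> = \<theta>" using coset_join2[OF h(1) assms(2,6)] a(2) by simp
  finally have fixed: "\<theta> #>\<^bsub>G\<^esub> h = \<theta>" .
  have "s \<theta> \<in> carrier G"
    using coset_section_cocycle(2)[OF assms(1,2,4,5) h(1)] .
  then show ?thesis using h by (simp add: fixed h(2)[symmetric] m_assoc)
qed

text \<open>An optimal tuple for H is used as a tuple in G. Being central, it produces the same
  pattern in all coordinates, so the product has equal factors and none falls short of the
  maximum.\<close>

lemma max_pattern_number_coind_ge:
  assumes "group G" and "countable (carrier G)" and "subgroup H G" and "H \<subseteq> group_center G"
    and fin: "finite (rcosets\<^bsub>G\<^esub> H)" and X: "tds (G\<lparr>carrier := H\<rparr>) X \<alpha>"
    and s: "coset_section G H s" and U: "open_cover X \<U>" and V: "open_cover X \<V>"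
    and star: "star_refines X \<V> \<U>"
  shows "max_pattern_number (G\<lparr>carrier := H\<rparr>) X \<alpha> \<U> n ^ card (rcosets\<^bsub>G\<^esub> H) \<le>
    max_pattern_number G (coind_space G H X) (coind_action G H s X \<alpha>)
      (cover_prod (rcosets\<^bsub>G\<^esub> H) (\<lambda>_. \<V>)) n"
proof -
  interpret group G by fact
  let ?R = "rcosets\<^bsub>G\<^esub> H" and ?P = "coind_space G H X" and ?\<beta> = "coind_action G H s X \<alpha>"
    and ?H = "G\<lparr>carrier := H\<rparr>"
  let ?c = "\<lambda>\<theta> g. s \<theta> \<otimes>\<^bsub>G\<^esub> g \<otimes>\<^bsub>G\<^esub> inv\<^bsub>G\<^esub> (s (\<theta> #>\<^bsub>G\<^esub> g))"
  have P: "tds G ?P ?\<beta>" using assms by (intro tds_coind)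
  have cpt: "compact_space X" using X by (simp add: tds_def)
  obtain h where h: "h \<in> {1..n} \<rightarrow> carrier ?H"
    "max_pattern_number ?H X \<alpha> \<U> n = cover_number X (pattern_join ?H X \<alpha> \<U> n h)"
    using max_pattern_number_attained[OF X U] .
  have hH: "h i \<in> H" if "i \<in> {1..n}" for i using h(1) that by auto
  have hG: "h \<in> {1..n} \<rightarrow> carrier G" using hH subgroup.mem_carrier[OF assms(3)] by blast
  have join: "cover_join X {1..n} (\<lambda>i. (\<lambda>U. \<alpha> (?c \<theta> (inv\<^bsub>G\<^esub> (h i))) ` U) ` \<V>) =
      pattern_join ?H X \<alpha> \<V> n h" if "\<theta> \<in> ?R" for \<theta>
  proof (rule cover_join_cong)
    fix i
    assume "i \<in> {1..n}"
    then have "?c \<theta> (inv\<^bsub>G\<^esub> (h i)) = inv\<^bsub>?H\<^esub> (h i)"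
      using central_cocycle[OF assms(1,3,4) s that] hH assms(3)
      by (simp add: m_inv_consistent subgroup.m_inv_closed)
    then show "(\<lambda>U. \<alpha> (?c \<theta> (inv\<^bsub>G\<^esub> (h i))) ` U) ` \<V> = (\<lambda>U. \<alpha> (inv\<^bsub>?H\<^esub> (h i)) ` U) ` \<V>"
      by (simp only:)
  qed
  have "max_pattern_number ?H X \<alpha> \<U> n ^ card ?R = (\<Prod>\<theta>\<in>?R. cover_number X (pattern_join ?H X \<alpha> \<U> n h))"
    by (simp add: h(2))
  also have "\<dots> \<le> cover_number (product_topology (\<lambda>_. X) ?R)
      (cover_prod ?R (\<lambda>_. pattern_join ?H X \<alpha> \<V> n h))"
  proof (rule prod_cover_number_le[OF fin cpt])
    show "open_cover X (pattern_join ?H X \<alpha> \<V> n h)" "open_cover X (pattern_join ?H X \<alpha> \<U> n h)"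
      using open_cover_pattern_join[OF X _ h(1)] U V by auto
    show "star_refines X (pattern_join ?H X \<alpha> \<V> n h) (pattern_join ?H X \<alpha> \<U> n h)"
      using h(1) V star
      by (intro star_refines_join star_refines_translate tds_homeomorphic_map_inv[OF X]) auto
  qed
  also have "cover_prod ?R (\<lambda>_. pattern_join ?H X \<alpha> \<V> n h) =
      pattern_join G ?P ?\<beta> (cover_prod ?R (\<lambda>_. \<V>)) n h"
    unfolding coind_pattern_join[OF assms(1,3) s hG V]
    using join by (auto simp: cover_prod_def)
  also have "cover_number (product_topology (\<lambda>_. X) ?R) \<dots> \<le>
      max_pattern_number G ?P ?\<beta> (cover_prod ?R (\<lambda>_. \<V>)) n"
    unfolding coind_space_def[symmetric]
    by (rule pattern_number_le_max[OF P _ hG])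
      (unfold coind_space_def, intro open_cover_prod fin V)
  finally show ?thesis .
qed

theorem theorem3p4:
  fixes G :: "('g, 'm) monoid_scheme" and H :: "'g set"
    and X :: "'x topology" and \<alpha> :: "'g \<Rightarrow> 'x \<Rightarrow> 'x" and s :: "'g set \<Rightarrow> 'g"
  assumes "group G"
    and "countable (carrier G)" and "infinite (carrier G)"
    and "subgroup H G"
    and "H \<subseteq> group_center G"
    and "finite (rcosets\<^bsub>G\<^esub> H)"
    and "tds (G\<lparr>carrier := H\<rparr>) X \<alpha>"
    and "coset_section G H s"
  shows "pattern_entropy G (coind_space G H X) (coind_action G H s X \<alpha>) =
         ereal (real (card (rcosets\<^bsub>G\<^esub> H))) * pattern_entropy (G\<lparr>carrier := H\<rparr>) X \<alpha>"
proof -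
  let ?R = "rcosets\<^bsub>G\<^esub> H" and ?P = "coind_space G H X" and ?\<beta> = "coind_action G H s X \<alpha>"
    and ?H = "G\<lparr>carrier := H\<rparr>"
  let ?k = "card ?R"
  have P: "tds G ?P ?\<beta>" using assms by (intro tds_coind)
  have X: "compact_space X" "metrizable_space X" using assms(7) by (simp_all add: tds_def)
  have "open_cover X {topspace X}" by (simp add: open_cover_def)
  then have ne: "Collect (open_cover X) \<noteq> {}" by blast
  \<comment> \<open>The factor can be pulled out of the supremum in \<open>ereal\<close> because the
    family is nonempty and nonnegative; the supremum may be infinite.\<close>
  have "(SUP \<U>\<in>Collect (open_cover X). ereal (real ?k) * ereal (pattern_entropy_cover ?H X \<alpha> \<U>)) =
      ereal (real ?k) * pattern_entropy ?H X \<alpha>"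
    unfolding pattern_entropy_def
    using pattern_entropy_cover_nonneg[OF assms(7)] ne by (intro SUP_ereal_mult_left) auto
  moreover have "pattern_entropy G ?P ?\<beta> =
      (SUP \<U>\<in>Collect (open_cover X). ereal (real ?k) * ereal (pattern_entropy_cover ?H X \<alpha> \<U>))"
    unfolding pattern_entropy_def
  \<comment> \<open>Each cover on one side needs only some cover on the other with at least its
    value; product covers suffice, although a cover of the product need not be of this form.\<close>
  proof (intro antisym SUP_mono)
    fix \<W>
    assume "\<W> \<in> Collect (open_cover ?P)"
    then have W: "open_cover ?P \<W>" by simp
    then obtain \<U> where U: "open_cover X \<U>" "\<And>V. V \<in> cover_prod ?R (\<lambda>_. \<U>) \<Longrightarrow> \<exists>W\<in>\<W>. V \<subseteq> W"
      using ex_cover_prod_refinement[OF X(1) assms(6)] unfolding coind_space_def by metis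
    have "pattern_entropy_cover G ?P ?\<beta> \<W> \<le> real ?k * pattern_entropy_cover ?H X \<alpha> \<U>"
      by (rule pattern_entropy_cover_le_mult[OF P W assms(7) U(1)])
        (rule max_pattern_number_coind_le[OF assms(1,2,4,6,7,8) U(1) W U(2)])
    then show "\<exists>\<U>\<in>Collect (open_cover X). ereal (pattern_entropy_cover G ?P ?\<beta> \<W>) \<le>
        ereal (real ?k) * ereal (pattern_entropy_cover ?H X \<alpha> \<U>)"
      using U(1) by auto
  next
    fix \<U>
    assume "\<U> \<in> Collect (open_cover X)"
    then have U: "open_cover X \<U>" by simp
    obtain \<V> where V: "open_cover X \<V>" "star_refines X \<V> \<U>"
      using ex_star_refinement[OF X U] .
    have PV: "open_cover ?P (cover_prod ?R (\<lambda>_. \<V>))"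
      unfolding coind_space_def using assms(6) V(1) by (intro open_cover_prod)
    have "real ?k * pattern_entropy_cover ?H X \<alpha> \<U> \<le>
        pattern_entropy_cover G ?P ?\<beta> (cover_prod ?R (\<lambda>_. \<V>))"
      by (rule pattern_entropy_cover_mult_le[OF assms(7) U P PV])
        (rule max_pattern_number_coind_ge[OF assms(1,2,4,5,6,7,8) U V])
    then show "\<exists>\<W>\<in>Collect (open_cover ?P). ereal (real ?k) * ereal (pattern_entropy_cover ?H X \<alpha> \<U>) \<le>
        ereal (pattern_entropy_cover G ?P ?\<beta> \<W>)"
      using PV by auto
  qed
  ultimately show ?thesis by simp
qed

end
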